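(* Let $n\ge 2$, $k_1,k_2>0$, and define $$\omega_n=\left(\frac{k_2^2n^2+\sqrt{k_2^4n^4+4k_1^2n^2}}{2}\right)^{1/2},\qquad \tau^*_n=\frac{1}{\omega_n}\arctan\!\left(\frac{k_2\omega_n}{k_1}\right).$$ If $0\le\tau<\tau_n^*$, then for every connected undirected graph on $n$ vertices, the $n$ agents $\ddot x_i(t)=u_i(t)$ communicating over that graph under the protocol $$u_i(t)=k_1\sum_{j\in\mathcal N_i}\bigl(x_j(t-\tau)-x_i(t-\tau)\bigr)+k_2\sum_{j\in\mathcal N_i}\bigl(\dot x_j(t-\tau)-\dot x_i(t-\tau)\bigr)$$ reach consensus.
   Context: $\mathcal N_i$ is the set of neighbours of agent $i$ in the (simple, undirected) communication graph; the delay $\tau$ is constant and uniform. The agents reach consensus if, for every initial history, $x_i(t)-x_j(t)\to 0$ and $\dot x_i(t)-\dot x_j(t)\to0$ as $t\to\infty$ for all $i,j$; equivalently, the disagreement factors $s^2+\lambda(k_2s+k_1)e^{-\tau s}$, for all nonzero eigenvalues $\lambda$ of the graph Laplacian, are all stable (all roots have negative real part). *)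

theory Defs
  imports "HOL-Analysis.Analysis" "Graph_Theory.Digraph_Component"
begin

text \<open>A communication graph is a \<open>pair_graph\<close>: a finite, loop-free, symmetric digraph
  whose arcs are ordered pairs of vertices, i.e. a finite simple undirected graph.\<close>

definition neighbours :: "'a pair_pre_digraph \<Rightarrow> 'a \<Rightarrow> 'a set" where
  "neighbours G i = {j. (i, j) \<in> parcs G}"

text \<open>Here \<open>x i\<close> and \<open>v i\<close> are position and velocity of agent \<open>i\<close> as functions of time; that
  \<open>v i\<close> is the derivative of \<open>x i\<close> is part of \<open>closed_loop_solution\<close> below.\<close>

definition protocol ::
  "'a pair_pre_digraph \<Rightarrow> real \<Rightarrow> real \<Rightarrow> real \<Rightarrow> ('a \<Rightarrow> real \<Rightarrow> real) \<Rightarrow> ('a \<Rightarrow> real \<Rightarrow> real)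
    \<Rightarrow> 'a \<Rightarrow> real \<Rightarrow> real" where
  "protocol G k1 k2 \<tau> x v i t =
     k1 * (\<Sum>j\<in>neighbours G i. x j (t - \<tau>) - x i (t - \<tau>)) +
     k2 * (\<Sum>j\<in>neighbours G i. v j (t - \<tau>) - v i (t - \<tau>))"

text \<open>Histories are continuously differentiable on \<open>[-\<tau>, 0]\<close>. The derivative \<open>\<phi>'\<close> is carried
  along explicitly so that for \<open>\<tau> = 0\<close>, where differentiability within \<open>{0}\<close> is no
  constraint, a history is an arbitrary pair of initial position and initial velocity.\<close>

definition initial_history ::
  "'a pair_pre_digraph \<Rightarrow> real \<Rightarrow> ('a \<Rightarrow> real \<Rightarrow> real) \<Rightarrow> ('a \<Rightarrow> real \<Rightarrow> real) \<Rightarrow> bool" where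
  "initial_history G \<tau> \<phi> \<phi>' \<longleftrightarrow>
     (\<forall>i\<in>pverts G.
        (\<forall>t\<in>{-\<tau>..0}. (\<phi> i has_real_derivative \<phi>' i t) (at t within {-\<tau>..0})) \<and>
        continuous_on {-\<tau>..0} (\<phi>' i))"

text \<open>The derivatives at the left endpoints \<open>t = -\<tau>\<close> (of \<open>x i\<close>) and \<open>t = 0\<close> (of \<open>v i\<close>) are
  one-sided.\<close>

definition closed_loop_solution ::
  "'a pair_pre_digraph \<Rightarrow> real \<Rightarrow> real \<Rightarrow> real \<Rightarrow> ('a \<Rightarrow> real \<Rightarrow> real) \<Rightarrow> ('a \<Rightarrow> real \<Rightarrow> real)
    \<Rightarrow> ('a \<Rightarrow> real \<Rightarrow> real) \<Rightarrow> ('a \<Rightarrow> real \<Rightarrow> real) \<Rightarrow> bool" where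
  "closed_loop_solution G k1 k2 \<tau> \<phi> \<phi>' x v \<longleftrightarrow>
     (\<forall>i\<in>pverts G.
        (\<forall>t\<in>{-\<tau>..0}. x i t = \<phi> i t \<and> v i t = \<phi>' i t) \<and>
        (\<forall>t\<in>{-\<tau>..}. (x i has_real_derivative v i t) (at t within {-\<tau>..})) \<and>
        (\<forall>t\<in>{0..}. (v i has_real_derivative protocol G k1 k2 \<tau> x v i t) (at t within {0..})))"

definition reaches_consensus :: "'a pair_pre_digraph \<Rightarrow> real \<Rightarrow> real \<Rightarrow> real \<Rightarrow> bool" where
  "reaches_consensus G k1 k2 \<tau> \<longleftrightarrow>
     (\<forall>\<phi> \<phi>' x v. initial_history G \<tau> \<phi> \<phi>' \<longrightarrow> closed_loop_solution G k1 k2 \<tau> \<phi> \<phi>' x v \<longrightarrow>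
        (\<forall>i\<in>pverts G. \<forall>j\<in>pverts G.
           ((\<lambda>t. x i t - x j t) \<longlongrightarrow> 0) at_top \<and> ((\<lambda>t. v i t - v j t) \<longlongrightarrow> 0) at_top))"

definition omega_crit :: "real \<Rightarrow> real \<Rightarrow> nat \<Rightarrow> real" where
  "omega_crit k1 k2 n =
     sqrt ((k2^2 * real n^2 + sqrt (k2^4 * real n^4 + 4 * k1^2 * real n^2)) / 2)"

definition tau_crit :: "real \<Rightarrow> real \<Rightarrow> nat \<Rightarrow> real" where
  "tau_crit k1 k2 n = 1 / omega_crit k1 k2 n * arctan (k2 * omega_crit k1 k2 n / k1)"

end

theory Submission
  imports Defs "HOL-Complex_Analysis.Complex_Analysis" "HOL-Probability.Probability"
    "HOL-Computational_Algebra.Fundamental_Theorem_Algebra"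
begin

text \<open>
  The graph Laplacian is self-adjoint, so \<open>x a - x b\<close> is a sum of modes \<open>y\<close>, one for each nonzero
  Laplacian eigenvalue \<open>l\<close>, satisfying \<open>y''(t) = - l (k1 y(t - \<tau>) + k2 y'(t - \<tau>))\<close>; moreover
  \<open>0 < l \<le> n\<close>. Since \<open>arctan u / u\<close> decreases and the crossover frequency increases with \<open>l\<close>,
  \<open>\<tau> < \<tau>*\<^sub>n\<close> gives the delay margin for every such \<open>l\<close>, and the characteristic function of each mode has
  no zero in the closed right half-plane.

  To pass from zeros to decay, multiply the mode by a smooth cutoff vanishing for small times. The
  product solves the same equation up to a compactly supported continuous forcing, so its Laplace
  transform is an entire function, bounded on vertical strips, divided by the characteristic
  function; it is \<open>O(|s|\<^sup>-\<^sup>2)\<close> on vertical lines. Fourier inversion and moving the line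
  of integration into the left half-plane give exponential decay of \<open>y\<close>, and the equation itself
  then forces \<open>y'\<close> to \<open>0\<close>.
\<close>

section \<open>Zeros of the characteristic function\<close>

text \<open>For l = n, \<open>omega_crit\<close> is the frequency w at which |s^2| = |l (k2 s + k1)|
  at s = i w, and \<open>tau_crit\<close> is the delay whose phase lag there uses up the lead arctan
  (k2 w / k1). It is the first delay at which the complete graph, whose nonzero Laplacian
  eigenvalues all equal n, acquires imaginary roots. The bound l <= n comes from comparing the
  Dirichlet energy of a graph with that of the complete graph. The obstacle on the analytic side is
  convergence: the transform of a solution started at time 0 decays only like 1/|s| on a vertical
  line, too slowly for an absolutely convergent inversion integral. Switching the mode on with two
  continuous derivatives gains the missing power, and it moves all dependence on the history into
  the compactly supported forcing. On the algebraic side the eigenvector expansion is applied to the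
  fixed vector that is 1 at a, -1 at b and 0 elsewhere, never to the trajectory, so the spectral
  argument is free of time.\<close>

definition char_fun :: "real \<Rightarrow> real \<Rightarrow> real \<Rightarrow> real \<Rightarrow> complex \<Rightarrow> complex" where
  "char_fun l k1 k2 \<tau> s = s^2 + of_real l * (of_real k2 * s + of_real k1) * exp (- of_real \<tau> * s)"

lemma char_fun_cnj: "char_fun l k1 k2 \<tau> (cnj s) = cnj (char_fun l k1 k2 \<tau> s)"
  by (simp add: char_fun_def exp_cnj)

lemma char_fun_real_pos:
  assumes "l > 0" "k1 > 0" "k2 > 0" "x \<ge> 0"
  shows "char_fun l k1 k2 \<tau> (of_real x) \<noteq> 0"
proof -
  have "char_fun l k1 k2 \<tau> (of_real x) = of_real (x^2 + l * (k2 * x + k1) * exp (- \<tau> * x))"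
    by (simp add: char_fun_def exp_of_real[symmetric])
  moreover have "x^2 + l * (k2 * x + k1) * exp (- \<tau> * x) > 0"
    using assms by (intro add_nonneg_pos mult_pos_pos add_nonneg_pos) auto
  ultimately show ?thesis by (metis less_irrefl of_real_eq_0_iff)
qed

text \<open>\<open>w4\<close> says that |s^2| and |l (k2 s + k1)| agree at s = i w, and
  \<open>crit\<close> that the phase lag \<open>\<tau> * w\<close> of the delay is still below the
  phase lead arctan (k2 w / k1) there. These are the modulus and the phase half of a Nyquist
  condition.\<close>

lemma char_fun_nonzero_upper:
  assumes l: "l > 0" and k1: "k1 > 0" and k2: "k2 > 0" and tau: "\<tau> \<ge> 0" and w: "w > 0"
    and w4: "w^4 = l^2 * (k2^2 * w^2 + k1^2)"
    and crit: "\<tau> * w < arctan (k2 * w / k1)"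
    and s: "Re s \<ge> 0" "Im s > 0"
  shows "char_fun l k1 k2 \<tau> s \<noteq> 0"
proof
  assume root: "char_fun l k1 k2 \<tau> s = 0"
  have s0: "s \<noteq> 0" using s by auto
  \<comment> \<open>In the coordinate \<open>z = ln s\<close> the characteristic equation reads \<open>F z \<in> 2\<pi>\<i>\<int>\<close>. On the strip
    \<open>0 \<le> Im z \<le> \<pi>/2\<close> (the closed first quadrant) \<open>Re F' < 0\<close>, and at \<open>ln (\<i>w)\<close> the value of \<open>F\<close> is \<open>\<i>c\<close>
    with \<open>c > 0\<close>. The mean value theorem along the segment from \<open>ln (\<i>w)\<close> to a putative root then
    yields the contradiction.\<close>
  define F where "F = (\<lambda>z::complex. of_real (ln l) + Ln (of_real k2 * exp z + of_real k1) - 2 * z + \<i> * of_real pi - of_real \<tau> * exp z)"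
  define F' where "F' = (\<lambda>z::complex. of_real k2 * exp z / (of_real k2 * exp z + of_real k1) - 2 - of_real \<tau> * exp z)"
  have Rexp: "Re (exp z) \<ge> 0" if "0 \<le> Im z" "Im z \<le> pi/2" for z
    unfolding Re_exp using that by (intro mult_nonneg_nonneg cos_ge_zero) auto
  have Rpos: "Re (of_real k2 * exp z + of_real k1) > 0" if "0 \<le> Im z" "Im z \<le> pi/2" for z
    using Rexp[OF that] k1 k2 by (simp add: add_nonneg_pos)
  have dF: "(F has_field_derivative F' z) (at z)" if "0 \<le> Im z" "Im z \<le> pi/2" for z
  proof -
    have "of_real k2 * exp z + of_real k1 \<notin> \<real>\<^sub>\<le>\<^sub>0"
      using Rpos[OF that] by (auto simp: complex_nonpos_Reals_iff)
    then show ?thesis unfolding F_def F'_def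
      by (auto intro!: derivative_eq_intros simp: divide_inverse)
  qed
  have F'neg: "Re (F' z) < 0" if "0 \<le> Im z" "Im z \<le> pi/2" for z
  proof -
    define q where "q = of_real k2 * exp z + of_real k1"
    have q: "Re q > 0" using Rpos[OF that] by (simp add: q_def)
    then have q0: "q \<noteq> 0" by auto
    \<comment> \<open>Since k1 / q has nonnegative real part, this quotient contributes at most 1 to
      Re F', and the -2 coming from s^2 outweighs it.\<close>
    have "of_real k2 * exp z / q = 1 - of_real k1 / q"
      using q0 by (simp add: q_def field_simps)
    moreover have "Re (of_real k1 / q) \<ge> 0"
      using q k1 by (simp add: Re_divide)
    ultimately have "Re (of_real k2 * exp z / q) \<le> 1" by simp
    moreover have "Re (of_real \<tau> * exp z) \<ge> 0" using Rexp[OF that] tau by simp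
    ultimately show ?thesis unfolding F'_def q_def by simp
  qed
  define w0 where "w0 = Ln s"
  define w1 where "w1 = Complex (ln w) (pi/2)"
  have e0: "exp w0 = s" using s0 by (simp add: w0_def)
  have im0: "0 \<le> Im w0" "Im w0 \<le> pi/2"
  proof -
    show "0 \<le> Im w0" unfolding w0_def using s Im_Ln_pos_le[OF s0] by auto
    show "Im w0 \<le> pi/2" unfolding w0_def using s Re_Ln_pos_le[OF s0] by auto
  qed
  have e1: "exp w1 = \<i> * of_real w"
    using w by (simp add: w1_def complex_eq_iff Re_exp Im_exp)
  define q0 where "q0 = of_real k2 * s + of_real k1"
  have q0: "Re q0 > 0" unfolding q0_def using s k1 k2 by (simp add: add_nonneg_pos)
  then have q0n: "q0 \<noteq> 0" by auto
  have sq: "s^2 = - (of_real l * q0 * exp (- of_real \<tau> * s))"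
    using root by (simp add: char_fun_def q0_def eq_neg_iff_add_eq_0)
  have expF0: "exp (F w0) = 1"
  proof -
    have "exp (F w0) = of_real l * q0 / s^2 * (-1) * exp (- of_real \<tau> * s)"
    proof -
      have "exp (2 * w0) = s^2" by (simp add: exp_double e0)
      moreover have "exp (complex_of_real (ln l)) = of_real l" using l by (simp add: exp_of_real)
      moreover have Fe: "F w0 = of_real (ln l) + Ln q0 - 2 * w0 + \<i> * of_real pi + (- of_real \<tau> * s)"
        by (simp add: F_def e0 q0_def)
      ultimately show ?thesis
        unfolding Fe using q0n exp_pi_i' by (simp add: exp_add exp_diff exp_minus divide_inverse)
    qed
    also have "\<dots> = 1" using sq s0 l q0n by (simp add: field_simps)
    finally show ?thesis .
  qed
  have ReF0: "Re (F w0) = 0" using expF0 by (metis exp_eq_1)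
  obtain m :: int where m: "Im (F w0) = of_int (2 * m) * pi" using expF0 by (metis exp_eq_1)
  \<comment> \<open>The only positive contributions are Im (Ln q0) <= pi/2 and the explicit pi.
    Staying below 2 pi forces the multiple of 2 pi found above to be at most 0.\<close>
  have "Im (F w0) < 2 * pi"
  proof -
    have "Im (Ln q0) \<le> pi/2" using Re_Ln_pos_le[OF q0n] q0 by auto
    moreover have "\<tau> * Im s \<ge> 0" using tau s by simp
    ultimately show ?thesis unfolding F_def e0 q0_def[symmetric] using im0 pi_gt_zero
      by (simp del: pi_gt_zero)
  qed
  then have "of_int m < (1::real)" using m by simp
  then have "m \<le> 0" by simp
  then have ImF0: "Im (F w0) \<le> 0" using m by (simp add: mult_nonpos_nonneg)
  define q1 where "q1 = of_real k2 * (\<i> * of_real w) + of_real k1"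
  have q1: "Re q1 = k1" "Im q1 = k2 * w" by (simp_all add: q1_def)
  then have q1n: "q1 \<noteq> 0" using k1 by (metis less_irrefl zero_complex.sel(1))
  have ReF1: "Re (F w1) = 0"
  proof -
    have n: "l * cmod q1 = w^2"
    proof (rule power2_eq_imp_eq)
      show "(l * cmod q1)\<^sup>2 = (w\<^sup>2)\<^sup>2"
        using w4 by (simp add: power_mult_distrib cmod_power2 q1 algebra_simps)
    qed (use l in auto)
    have "ln l + ln (cmod q1) = ln (w^2)" 
      using l q1n by (simp add: n[symmetric] ln_mult)
    then show ?thesis
      unfolding F_def e1 q1_def[symmetric] using w q1n by (simp add: w1_def ln_realpow)
  qed
  \<comment> \<open>At ln (i w) the terms -2 z and i pi cancel in the imaginary part, leaving arctan
    (k2 w / k1) - \<open>\<tau> * w\<close>, whose positivity is exactly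
    \<open>crit\<close>.\<close>
  have ImF1: "Im (F w1) > 0"
  proof -
    have "Im (Ln q1) = arctan (k2 * w / k1)"
      using q1 k1 Arg_eq_Im_Ln[OF q1n] arg_conv_arctan[of q1] by simp
    then show ?thesis unfolding F_def e1 q1_def[symmetric] using crit by (simp add: w1_def)
  qed
  have im1: "0 \<le> Im w1" "Im w1 \<le> pi/2" by (auto simp: w1_def)
  define d where "d = w0 - w1"
  have d0: "d \<noteq> 0" using ImF0 ImF1 by (auto simp: d_def)
  have dIm: "Im d \<le> 0" using im0 by (simp add: d_def w1_def)
  \<comment> \<open>Multiplying by \<open>cnj d\<close> turns the derivative along the segment into
    |d|^2 F', so \<open>p\<close> strictly decreases. Both values of F at the ends are imaginary, so
    p 1 - p 0 is a product of two nonpositive numbers: \<open>Im d\<close> is nonpositive because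
    \<open>w1\<close> lies on the top edge of the strip.\<close>
  define p where "p = (\<lambda>t::real. Re (F (w1 + of_real t * d) * cnj d))"
  have "p 1 < p 0"
  proof (rule DERIV_neg_imp_decreasing[of 0 1])
    fix t :: real assume t: "0 \<le> t" "t \<le> 1"
    define z where "z = w1 + of_real t * d"
    have "Im z = (1 - t) * Im w1 + t * Im w0" by (simp add: z_def d_def algebra_simps)
    moreover have "(1 - t) * Im w1 + t * Im w0 \<le> (1-t) * (pi/2) + t * (pi/2)"
      using t im0 im1 by (intro add_mono mult_left_mono) auto
    moreover have "(1 - t) * (pi/2) + t * (pi/2) = pi/2" using distrib_right[of "1 - t" t "pi/2"] by simp
    moreover have "0 \<le> (1 - t) * Im w1 + t * Im w0" using t im0 im1 by simp
    ultimately have z: "0 \<le> Im z" "Im z \<le> pi/2" by linarith+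
    have "((\<lambda>t. w1 + of_real t * d) has_vector_derivative d) (at t)"
      by (auto intro!: derivative_eq_intros simp: has_vector_derivative_def scaleR_conv_of_real)
    from field_vector_diff_chain_at[OF this, of F "F' z"] dF[OF z]
    have "((\<lambda>t. F (w1 + of_real t * d)) has_vector_derivative d * F' z) (at t)"
      by (simp add: z_def o_def)
    then have "((\<lambda>t. F (w1 + of_real t * d) * cnj d) has_vector_derivative d * F' z * cnj d) (at t)"
      by (rule has_vector_derivative_mult_left)
    then have "(p has_vector_derivative Re (d * F' z * cnj d)) (at t)"
      unfolding p_def
      using bounded_linear.has_vector_derivative[OF bounded_linear_Re] by blast
    moreover have "d * F' z * cnj d = of_real ((cmod d)^2) * F' z"
      by (metis complex_norm_square mult.commute mult.left_commute)
    ultimately have "(p has_real_derivative (cmod d)^2 * Re (F' z)) (at t)"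
      by (simp add: has_real_derivative_iff_has_vector_derivative)
    moreover have "(cmod d)^2 * Re (F' z) < 0"
      using F'neg[OF z] d0 by (simp add: mult_pos_neg)
    ultimately show "\<exists>y. (p has_real_derivative y) (at t) \<and> y < 0" by blast
  qed auto
  moreover have "p 1 - p 0 = (Im (F w0) - Im (F w1)) * Im d"
    using ReF0 ReF1 by (simp add: p_def d_def algebra_simps)
  moreover have "(Im (F w0) - Im (F w1)) * Im d \<ge> 0"
    using ImF0 ImF1 dIm by (intro mult_nonpos_nonpos) auto
  ultimately show False by simp
qed

lemma char_fun_nonzero:
  assumes l: "l > 0" and k1: "k1 > 0" and k2: "k2 > 0" and tau: "\<tau> \<ge> 0" and w: "w > 0"
    and w4: "w^4 = l^2 * (k2^2 * w^2 + k1^2)"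
    and crit: "\<tau> * w < arctan (k2 * w / k1)"
    and s: "Re s \<ge> 0"
  shows "char_fun l k1 k2 \<tau> s \<noteq> 0"
proof (cases "Im s" "0::real" rule: linorder_cases)
  case less
  then have "char_fun l k1 k2 \<tau> (cnj s) \<noteq> 0"
    using char_fun_nonzero_upper[OF l k1 k2 tau w w4 crit, of "cnj s"] s by simp
  then show ?thesis by (simp add: char_fun_cnj)
next
  case equal
  then have "s = of_real (Re s)" by (simp add: complex_eq_iff)
  then show ?thesis using char_fun_real_pos[OF l k1 k2 s] by metis
next
  case greater
  then show ?thesis using char_fun_nonzero_upper[OF l k1 k2 tau w w4 crit] s by simp
qed

section \<open>Crossover frequency and delay margin as functions of the eigenvalue\<close>

lemma arctan_mult_antimono:
  assumes "0 < u" "u \<le> v"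
  shows "u * arctan v \<le> v * arctan u"
proof -
  define h where "h = (\<lambda>x. arctan x / x)"
  \<comment> \<open>This inequality is the sign of the numerator in the derivative of arctan x /
    x.\<close>
  have tan: "x / (1 + x^2) \<le> arctan x" if "x > 0" for x :: real
  proof -
    have "\<exists>z>0. z < x \<and> arctan x - arctan 0 = (x - 0) * inverse (1 + z^2)"
      using that by (intro MVT2) (auto intro!: derivative_eq_intros)
    then obtain z where z: "0 < z" "z < x" "arctan x = x * inverse (1 + z^2)" by auto
    have "inverse (1 + x^2) \<le> inverse (1 + z^2)"
      using z by (intro le_imp_inverse_le) (auto intro!: power_mono add_pos_nonneg)
    then show ?thesis using z that by (simp add: divide_inverse)
  qed
  have "h v \<le> h u"
  proof (rule DERIV_nonpos_imp_nonincreasing[OF assms(2)])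
    fix x assume x: "u \<le> x" "x \<le> v"
    then have x0: "x > 0" using assms by simp
    have "(h has_real_derivative (inverse (1 + x^2) * x - arctan x * 1) / (x * x)) (at x)"
      unfolding h_def using x0 by (intro DERIV_divide DERIV_arctan DERIV_ident) auto
    moreover have "(inverse (1 + x^2) * x - arctan x * 1) / (x * x) \<le> 0"
      using tan[OF x0] by (intro divide_nonpos_nonneg) (auto simp: field_simps)
    ultimately show "\<exists>y. (h has_real_derivative y) (at x) \<and> y \<le> 0" by blast
  qed
  then show ?thesis using assms by (simp add: h_def field_simps)
qed

text \<open>Extension of \<open>omega_crit\<close> to a real eigenvalue l. Its square is the
  nonnegative root X of X^2 = l^2 (k2^2 X + k1^2), the modulus condition on the imaginary
  axis.\<close>

definition omega :: "real \<Rightarrow> real \<Rightarrow> real \<Rightarrow> real" where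
  "omega k1 k2 l = sqrt ((k2^2 * l^2 + sqrt (k2^4 * l^4 + 4 * k1^2 * l^2)) / 2)"

lemma omega_crit_eq: "omega_crit k1 k2 n = omega k1 k2 (real n)"
  by (simp add: omega_crit_def omega_def)

lemma omega_pos: "k1 > 0 \<Longrightarrow> k2 > 0 \<Longrightarrow> l > 0 \<Longrightarrow> omega k1 k2 l > 0"
  unfolding omega_def by (intro real_sqrt_gt_zero divide_pos_pos add_pos_nonneg) auto

lemma omega_mono: "0 \<le> l \<Longrightarrow> l \<le> l' \<Longrightarrow> omega k1 k2 l \<le> omega k1 k2 l'"
  unfolding omega_def
  by (intro real_sqrt_le_mono divide_right_mono add_mono mult_left_mono power_mono) auto

lemma omega_power4:
  "omega k1 k2 l ^ 4 = l^2 * (k2^2 * (omega k1 k2 l)^2 + k1^2)"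
proof -
  define r where "r = sqrt (k2^4 * l^4 + 4 * k1^2 * l^2)"
  have r: "r^2 = k2^4 * l^4 + 4 * k1^2 * l^2" "r \<ge> 0" by (simp_all add: r_def)
  have w2: "(omega k1 k2 l)^2 = (k2^2 * l^2 + r) / 2"
    unfolding omega_def r_def[symmetric] using r by simp
  have "omega k1 k2 l ^ 4 = ((omega k1 k2 l)^2)^2" by simp
  also have "\<dots> = l^2 * (k2^2 * (omega k1 k2 l)^2 + k1^2)"
    unfolding w2 power_divide power2_sum r(1) by (simp add: field_simps power2_eq_square power4_eq_xxxx)
  finally show ?thesis .
qed

lemma char_fun_nonzero_tau_crit:
  assumes l: "0 < l" "l \<le> real n" and k1: "k1 > 0" and k2: "k2 > 0"
    and tau: "\<tau> \<ge> 0" "\<tau> < tau_crit k1 k2 n" and s: "Re s \<ge> 0"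
  shows "char_fun l k1 k2 \<tau> s \<noteq> 0"
proof (rule char_fun_nonzero[OF l(1) k1 k2 tau(1) _ omega_power4 _ s])
  let ?w = "omega k1 k2 l" and ?W = "omega k1 k2 (real n)"
  show w: "?w > 0" using l k1 k2 by (simp add: omega_pos)
  have le: "?w \<le> ?W" using l by (intro omega_mono) auto
  have W: "?W > 0" using w le by simp
  have "\<tau> * ?W < arctan (k2 * ?W / k1)"
    using tau(2) W by (simp add: tau_crit_def omega_crit_eq field_simps)
  \<comment> \<open>The factor k2 w / k1 prepares the denominator-free comparison of arctan u / u;
    the common factor k2 W / k1 cancels at the end.\<close>
  then have "\<tau> * ?W * (k2 * ?w / k1) < arctan (k2 * ?W / k1) * (k2 * ?w / k1)"
    using w k1 k2 by (intro mult_strict_right_mono) auto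
  also have "\<dots> \<le> (k2 * ?W / k1) * arctan (k2 * ?w / k1)"
    using arctan_mult_antimono[of "k2 * ?w / k1" "k2 * ?W / k1"] w W le k1 k2
    by (simp add: divide_right_mono mult.commute)
  finally have "(k2 * ?W / k1) * (\<tau> * ?w) < (k2 * ?W / k1) * arctan (k2 * ?w / k1)"
    by (simp add: field_simps)
  then show "\<tau> * ?w < arctan (k2 * ?w / k1)"
    using W k1 k2 by (subst (asm) mult_less_cancel_left_pos) auto
qed

section \<open>Fourier inversion\<close>

text \<open>Serves two purposes: integration by parts for the Laplace transform, and the change of
  integration line, where \<open>f\<close> is the difference of a complex primitive between two
  vertical lines.\<close>

lemma integral_derivative_eq_0:
  fixes f f' :: "real \<Rightarrow> complex"
  assumes d: "\<And>t. (f has_vector_derivative f' t) (at t)"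
    and c: "continuous_on UNIV f'" and i: "integrable lborel f'"
    and top: "(f \<longlongrightarrow> 0) at_top" and bot: "(f \<longlongrightarrow> 0) at_bot"
  shows "(\<integral>t. f' t \<partial>lborel) = 0"
proof -
  have "(LBINT x=-\<infinity>..\<infinity>. f' x) = 0 - 0"
  proof (rule interval_integral_FTC_integrable)
    show "isCont f' x" for x using c by (simp add: continuous_on_eq_continuous_at)
    show "set_integrable lborel (einterval (-\<infinity>) \<infinity>) f'" using i by (simp add: set_integrable_def)
    show "((f \<circ> real_of_ereal) \<longlongrightarrow> 0) (at_right (-\<infinity>))"
      using bot by (simp add: at_right_MInf filterlim_filtermap o_def)
    show "((f \<circ> real_of_ereal) \<longlongrightarrow> 0) (at_left \<infinity>)"
      using top by (simp add: at_left_PInf filterlim_filtermap o_def)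
  qed (use d in auto)
  then show ?thesis by (simp add: interval_lebesgue_integral_def set_lebesgue_integral_def)
qed

text \<open>The Gaussian is its own Fourier transform up to scaling: a substitution reduces the
  integral to the characteristic function of the standard normal distribution.\<close>

lemma integral_iexp_std_normal_scaled:
  assumes "e > 0"
  shows "(\<integral>w. iexp (w * r) * complex_of_real (std_normal_density (e * w)) \<partial>lborel)
       = of_real (sqrt (2 * pi) / e * std_normal_density (r / e))"
proof -
  have "(\<integral>w. iexp (w * r) * complex_of_real (std_normal_density (e * w)) \<partial>lborel)
      = (1/e) *\<^sub>R (\<integral>x. iexp ((0 + (1/e) * x) * r) * complex_of_real (std_normal_density (e * (0 + (1/e) * x))) \<partial>lborel)"
    using assms by (subst lborel_integral_real_affine[where c = "1/e" and t = 0]) auto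
  also have "(\<integral>x. iexp ((0 + (1/e) * x) * r) * complex_of_real (std_normal_density (e * (0 + (1/e) * x))) \<partial>lborel)
      = (\<integral>x. std_normal_density x *\<^sub>R iexp ((r / e) * x) \<partial>lborel)"
    using assms by (intro Bochner_Integration.integral_cong) (auto simp: scaleR_conv_of_real mult.commute)
  also have "\<dots> = char std_normal_distribution (r / e)"
    unfolding char_def by (subst integral_density) (auto simp: normal_density_nonneg)
  also have "\<dots> = of_real (exp (- (r/e)\<^sup>2 / 2))" by (simp add: char_std_normal_distribution)
  also have "exp (- (r/e)\<^sup>2 / 2) = sqrt (2*pi) * std_normal_density (r/e)"
    by (simp add: std_normal_density_def)
  finally show ?thesis using assms by (simp add: scaleR_conv_of_real)
qed

lemma std_normal_density_le: "std_normal_density x \<le> std_normal_density 0"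
  by (simp add: std_normal_density_def divide_right_mono)

text \<open>Gaussian regularisation. Inserting the factor \<open>std_normal_density (e * w)\<close>
  turns the inversion integral into an average of \<open>f\<close> around t on scale e, and
  dominated convergence lets e tend to 0 on both sides.\<close>

lemma fourier_inversion:
  fixes f F :: "real \<Rightarrow> complex"
  assumes cont: "continuous_on UNIV f" and bnd: "\<And>u. norm (f u) \<le> K"
    and int: "integrable lborel f"
    and F: "\<And>w. F w = (\<integral>u. f u * iexp (- (w * u)) \<partial>lborel)"
    and Fint: "integrable lborel F"
  shows "(\<integral>w. F w * iexp (w * t) \<partial>lborel) = of_real (2 * pi) * f t"
proof -
  let ?n = std_normal_density
  have [measurable]: "f \<in> borel_measurable borel" "F \<in> borel_measurable borel"
    using int Fint by (auto dest: borel_measurable_integrable)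
  have nint: "integrable lborel (\<lambda>w. ?n (e * w))" if "e > 0" for e
    using lborel_integrable_real_affine[of ?n e 0] that integrable_std_normal_moment[of 0] by simp
  have key: "(\<integral>w. F w * iexp (w * t) * of_real (?n (e * w)) \<partial>lborel)
      = of_real (sqrt (2*pi)) * (\<integral>v. ?n v *\<^sub>R f (t - e * v) \<partial>lborel)" if e: "e > 0" for e
  proof -
    let ?g = "\<lambda>u w. f u * (iexp (w * (t - u)) * of_real (?n (e * w)))"
    have "(\<integral>w. F w * iexp (w * t) * of_real (?n (e * w)) \<partial>lborel)
        = (\<integral>w. (\<integral>u. ?g u w \<partial>lborel) \<partial>lborel)"
    proof (rule Bochner_Integration.integral_cong[OF refl])
      fix w
      have "F w * iexp (w * t) * of_real (?n (e * w))
        = (\<integral>u. (f u * iexp (- (w * u))) * (iexp (w * t) * of_real (?n (e * w))) \<partial>lborel)"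
        unfolding F integral_mult_left_zero by (simp only: mult.assoc)
      also have "\<dots> = (\<integral>u. ?g u w \<partial>lborel)"
        by (intro Bochner_Integration.integral_cong)
           (auto simp: exp_add[symmetric] algebra_simps mult_exp_exp)
      finally show "F w * iexp (w * t) * of_real (?n (e * w)) = (\<integral>u. ?g u w \<partial>lborel)" .
    qed
    also have "\<dots> = (\<integral>u. (\<integral>w. ?g u w \<partial>lborel) \<partial>lborel)"
    proof (rule lborel_pair.Fubini_integral, rule lborel_pair.Fubini_integrable)
      show "(\<lambda>(u, w). ?g u w) \<in> borel_measurable (lborel \<Otimes>\<^sub>M lborel)" by measurable
      \<comment> \<open>The oscillating factor has modulus 1, so the absolute integrand splits into
        an integrable function of u times an integrable function of w, as Fubini requires.\<close>
      have nn: "norm (?g u w) = norm (f u) * ?n (e * w)" for u w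
        by (simp add: norm_mult)
      show "integrable lborel (\<lambda>u. \<integral>w. norm (case (u, w) of (u, w) \<Rightarrow> ?g u w) \<partial>lborel)"
        unfolding prod.case nn integral_mult_right_zero using int by simp
      show "AE u in lborel. integrable lborel (\<lambda>w. case (u, w) of (u, w) \<Rightarrow> ?g u w)"
      proof (rule AE_I2)
        fix u
        show "integrable lborel (\<lambda>w. case (u, w) of (u, w) \<Rightarrow> ?g u w)"
          by (rule Bochner_Integration.integrable_bound[where f = "\<lambda>w. norm (f u) * ?n (e * w)"])
             (use nint[OF e] in \<open>auto simp: norm_mult\<close>)
      qed
    qed
    also have "\<dots> = (\<integral>u. f u * of_real (sqrt (2 * pi) / e * ?n ((t - u) / e)) \<partial>lborel)"
      by (simp only: integral_mult_right_zero integral_iexp_std_normal_scaled[OF e])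
    also have "\<dots> = \<bar>- e\<bar> *\<^sub>R (\<integral>v. f (t + (-e) * v) * of_real (sqrt (2 * pi) / e * ?n ((t - (t + (-e) * v)) / e)) \<partial>lborel)"
      using e by (intro lborel_integral_real_affine) auto
    also have "\<dots> = (\<integral>v. of_real (sqrt (2*pi)) * (?n v *\<^sub>R f (t - e * v)) \<partial>lborel)"
      using e unfolding integral_scaleR_right[symmetric]
      by (intro Bochner_Integration.integral_cong) (auto simp: scaleR_conv_of_real)
    finally show ?thesis by (simp only: integral_mult_right_zero)
  qed
  define e where "e = (\<lambda>k::nat. 1 / real (Suc k))"
  have e0: "e k > 0" for k by (simp add: e_def)
  have elim: "e \<longlonglongrightarrow> 0" unfolding e_def by (rule LIMSEQ_Suc[OF lim_1_over_n])
  have ncont: "isCont ?n x" for x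
    unfolding std_normal_density_def by (intro continuous_intros) auto
  have L1: "(\<lambda>k. \<integral>w. F w * iexp (w * t) * of_real (?n (e k * w)) \<partial>lborel)
      \<longlonglongrightarrow> (\<integral>w. F w * iexp (w * t) * of_real (?n 0) \<partial>lborel)"
  proof (rule integral_dominated_convergence[where w = "\<lambda>w. norm (F w) * ?n 0"])
    show "AE w in lborel. (\<lambda>k. F w * iexp (w * t) * of_real (?n (e k * w))) \<longlonglongrightarrow> F w * iexp (w * t) * of_real (?n 0)"
    proof (rule AE_I2)
      fix w
      have "(\<lambda>k. e k * w) \<longlonglongrightarrow> 0" using tendsto_mult_right[OF elim, of w] by simp
      then have "(\<lambda>k. ?n (e k * w)) \<longlonglongrightarrow> ?n 0" using isCont_tendsto_compose[OF ncont] by blast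
      then show "(\<lambda>k. F w * iexp (w * t) * of_real (?n (e k * w))) \<longlonglongrightarrow> F w * iexp (w * t) * of_real (?n 0)"
        by (intro tendsto_intros)
    qed
    show "AE w in lborel. norm (F w * iexp (w * t) * of_real (?n (e k * w))) \<le> norm (F w) * ?n 0" for k
      using std_normal_density_le by (auto simp: norm_mult intro!: mult_left_mono)
  qed (use Fint in auto)
  \<comment> \<open>Continuity of \<open>f\<close> gives the pointwise limit and the bound K gives
    the majorant K times the density.\<close>
  have L2: "(\<lambda>k. \<integral>v. ?n v *\<^sub>R f (t - e k * v) \<partial>lborel) \<longlonglongrightarrow> (\<integral>v. ?n v *\<^sub>R f t \<partial>lborel)"
  proof (rule integral_dominated_convergence[where w = "\<lambda>v. ?n v * K"])
    show "AE v in lborel. (\<lambda>k. ?n v *\<^sub>R f (t - e k * v)) \<longlonglongrightarrow> ?n v *\<^sub>R f t"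
    proof (rule AE_I2)
      fix v
      have "(\<lambda>k. t - e k * v) \<longlonglongrightarrow> t - 0 * v" by (intro tendsto_intros elim)
      then have "(\<lambda>k. f (t - e k * v)) \<longlonglongrightarrow> f t"
        using isCont_tendsto_compose[of t f] cont by (simp add: continuous_on_eq_continuous_at)
      then show "(\<lambda>k. ?n v *\<^sub>R f (t - e k * v)) \<longlonglongrightarrow> ?n v *\<^sub>R f t" by (intro tendsto_intros)
    qed
    show "integrable lborel (\<lambda>v. ?n v * K)" using nint[of 1] by simp
    show "AE v in lborel. norm (?n v *\<^sub>R f (t - e k * v)) \<le> ?n v * K" for k
      using bnd by (auto intro!: mult_left_mono)
  qed auto
  have "(\<integral>v. ?n v *\<^sub>R f t \<partial>lborel) = f t"
    using integrable_std_normal_moment[of 0] integral_std_normal_moment_even[of 0] by simp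
  with L2 have "(\<lambda>k. of_real (sqrt (2*pi)) * (\<integral>v. ?n v *\<^sub>R f (t - e k * v) \<partial>lborel)) \<longlonglongrightarrow> of_real (sqrt (2*pi)) * f t"
    by (intro tendsto_intros) simp
  then have "(\<integral>w. F w * iexp (w * t) * of_real (?n 0) \<partial>lborel) = of_real (sqrt (2*pi)) * f t"
    using LIMSEQ_unique[OF L1[unfolded key[OF e0]]] by blast
  then have "(\<integral>w. F w * iexp (w * t) \<partial>lborel) * of_real (?n 0) = of_real (sqrt (2*pi)) * f t"
    by simp
  moreover have "?n 0 = 1 / sqrt (2 * pi)" by (simp add: std_normal_density_def)
  ultimately have "(\<integral>w. F w * iexp (w * t) \<partial>lborel) = of_real (sqrt (2*pi)) * of_real (sqrt (2*pi)) * f t"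
    by (simp add: field_simps)
  then show ?thesis by (simp flip: of_real_mult)
qed

section \<open>Laplace transforms of causal functions\<close>

text \<open>On a strip the delay factor is bounded, so s^2 dominates for large |Im s|; what remains
  is a compact box, where the absence of zeros extends a little to the left of the imaginary axis.
  The quadratic lower bound is what later makes integrals over vertical lines converge
  absolutely.\<close>

lemma char_fun_lower_bound_strip:
  assumes nz: "\<And>s. Re s \<ge> 0 \<Longrightarrow> char_fun l k1 k2 \<tau> s \<noteq> 0"
    and pos: "l \<ge> 0" "k1 \<ge> 0" "k2 \<ge> 0" "\<tau> \<ge> 0" "c \<ge> 0"
  obtains \<delta> m where "0 < \<delta>" "\<delta> \<le> 1" "0 < m"
    "\<And>s. - \<delta> \<le> Re s \<Longrightarrow> Re s \<le> c \<Longrightarrow> m * (1 + (Im s)\<^sup>2) \<le> cmod (char_fun l k1 k2 \<tau> s)"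
proof -
  \<comment> \<open>For Re s >= -1 the factor l |exp (- \<open>\<tau>\<close> s)| is at most
    \<open>E\<close>, and |k2 s + k1| <= A |Im s| once |Im s| >= 1. The threshold \<open>R\<close>
    makes the delayed term at most a quarter of |Im s|^2.\<close>
  define E where "E = l * exp \<tau>"
  define A where "A = k2 * (1 + c) + k1 + k2"
  define R where "R = max 1 (4 * E * A)"
  have E: "E \<ge> 0" and A: "A \<ge> 0" using pos by (simp_all add: E_def A_def)
  have large: "1/4 * (1 + (Im s)\<^sup>2) \<le> cmod (char_fun l k1 k2 \<tau> s)"
    if s: "- 1 \<le> Re s" "Re s \<le> c" "\<bar>Im s\<bar> \<ge> R" for s
  proof -
    define y where "y = \<bar>Im s\<bar>"
    have y: "y \<ge> 1" "y \<ge> 4 * E * A" using s by (auto simp: y_def R_def)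
    have "cmod s \<le> \<bar>Re s\<bar> + \<bar>Im s\<bar>" by (rule cmod_le)
    also have "\<dots> \<le> (1 + c) + y" using s pos by (simp add: y_def)
    finally have cs: "cmod s \<le> (1 + c) + y" .
    have "cmod (of_real k2 * s + of_real k1) \<le> k2 * cmod s + k1"
      using norm_triangle_ineq[of "of_real k2 * s" "of_real k1"] pos by (simp add: norm_mult)
    also have "\<dots> \<le> k2 * ((1 + c) + y) + k1" using cs pos by (simp add: mult_left_mono)
    also have "\<dots> = k2 * (1 + c) + k1 + k2 * y" by (simp add: algebra_simps)
    also have "\<dots> \<le> (k2 * (1 + c) + k1) * y + k2 * y"
      using y pos mult_left_mono[of 1 y "k2 * (1 + c) + k1"] by simp
    finally have 1: "cmod (of_real k2 * s + of_real k1) \<le> A * y" by (simp add: A_def algebra_simps)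
    have "- \<tau> * Re s \<le> \<tau>" using mult_left_mono[OF s(1) pos(4)] by simp
    then have 2: "cmod (exp (- of_real \<tau> * s)) \<le> exp \<tau>" by simp
    have "cmod (of_real l * (of_real k2 * s + of_real k1) * exp (- of_real \<tau> * s)) \<le> l * (A * y) * exp \<tau>"
      unfolding norm_mult using 1 2 pos A y by (intro mult_mono) auto
    also have "\<dots> = (E * A) * y" by (simp add: E_def)
    also have "\<dots> \<le> (y / 4) * y" using y by (intro mult_right_mono) auto
    finally have 3: "cmod (of_real l * (of_real k2 * s + of_real k1) * exp (- of_real \<tau> * s)) \<le> y^2 / 4"
      by (simp add: power2_eq_square)
    have "y^2 \<le> (cmod s)^2" unfolding y_def using abs_Im_le_cmod by (intro power_mono) auto
    then have "y^2 \<le> cmod (s^2)" by (simp add: norm_power)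
    then have "y^2 - y^2/4 \<le> cmod (char_fun l k1 k2 \<tau> s)"
      unfolding char_fun_def using 3 norm_diff_ineq[of "s^2"] by (smt (verit))
    moreover have "1 \<le> y^2" using y by simp
    moreover have "(Im s)^2 = y^2" by (simp add: y_def)
    ultimately show ?thesis by simp
  qed
  let ?box = "\<lambda>a. cbox (Complex a (-R)) (Complex c R)"
  have mem: "s \<in> ?box a \<longleftrightarrow> a \<le> Re s \<and> Re s \<le> c \<and> \<bar>Im s\<bar> \<le> R" for s a
    by (auto simp: in_cbox_complex_iff)
  have cont: "continuous_on X (char_fun l k1 k2 \<tau>)" for X
    unfolding char_fun_def by (intro continuous_intros)
  define Z where "Z = ?box (-1) \<inter> char_fun l k1 k2 \<tau> -` {0}"
  have Zc: "compact Z" unfolding Z_def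
    by (intro compact_Int_closed compact_cbox continuous_closed_vimage closed_singleton)
       (use cont[of UNIV] in \<open>simp add: continuous_on_eq_continuous_at\<close>)
  \<comment> \<open>\<open>Z\<close> is the compact set of zeros in the box. Half the distance from
    its rightmost point to the imaginary axis works, capped at 1 because the estimate for large |Im
    s| needs Re s >= -1.\<close>
  obtain \<delta> where \<delta>: "0 < \<delta>" "\<delta> \<le> 1" "\<And>s. s \<in> Z \<Longrightarrow> Re s < - \<delta>"
  proof (cases "Z = {}")
    case True then show ?thesis using that[of 1] by simp
  next
    case False
    obtain x where x: "x \<in> Z" "\<forall>y\<in>Z. Re y \<le> Re x"
      using continuous_attains_sup[OF Zc False continuous_on_Re[OF continuous_on_id]] by auto
    have "Re x < 0" using x(1) nz[of x] by (force simp: Z_def not_le[symmetric])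
    then show ?thesis using x by (intro that[of "min 1 (- Re x / 2)"]) (auto simp: min_def)
  qed
  have nz': "char_fun l k1 k2 \<tau> s \<noteq> 0" if "s \<in> ?box (-\<delta>)" for s
    using \<delta>(2) \<delta>(3)[of s] that unfolding Z_def by (auto simp: mem)
  have "0 \<in> ?box (-\<delta>)" unfolding mem using \<delta> pos by (simp add: R_def)
  then obtain x where x: "x \<in> ?box (-\<delta>)"
    "\<forall>y \<in> ?box (-\<delta>). cmod (char_fun l k1 k2 \<tau> x) \<le> cmod (char_fun l k1 k2 \<tau> y)"
    using continuous_attains_inf[OF compact_cbox _ continuous_on_norm[OF cont]] by (metis empty_iff)
  define m0 where "m0 = cmod (char_fun l k1 k2 \<tau> x)"
  have m0: "m0 > 0" using nz'[OF x(1)] by (simp add: m0_def)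
  define m where "m = min (1/4) (m0 / (1 + R^2))"
  have R2: "1 + R^2 > 0" by (simp add: add_pos_nonneg)
  have m: "m > 0" using m0 R2 by (simp add: m_def)
  have m_le: "m \<le> 1/4" "m \<le> m0 / (1 + R^2)" unfolding m_def by (rule min.cobounded1 min.cobounded2)+
  show ?thesis
  proof (rule that[OF \<delta>(1,2) m])
    fix s assume s: "- \<delta> \<le> Re s" "Re s \<le> c"
    show "m * (1 + (Im s)\<^sup>2) \<le> cmod (char_fun l k1 k2 \<tau> s)"
    proof (cases "\<bar>Im s\<bar> \<ge> R")
      case True
      have "m * (1 + (Im s)\<^sup>2) \<le> 1/4 * (1 + (Im s)\<^sup>2)" using m_le by (intro mult_right_mono) auto
      then show ?thesis using large[of s] s \<delta> True by linarith
    next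
      case False
      then have "s \<in> ?box (-\<delta>)" using s by (simp add: mem)
      then have "m0 \<le> cmod (char_fun l k1 k2 \<tau> s)" using x by (simp add: m0_def)
      moreover have "(Im s)^2 \<le> R^2" using False by (simp add: abs_le_square_iff[symmetric])
      then have "m * (1 + (Im s)\<^sup>2) \<le> m0 / (1 + R^2) * (1 + R^2)"
        using m0 R2 m_le by (intro mult_mono) auto
      ultimately show ?thesis using R2 by simp
    qed
  qed
qed

section \<open>The Laplace transform as an integral over the whole line\<close>

lemma integrable_inverse_square: "integrable lborel (\<lambda>x::real. inverse (1 + x^2))"
  using integrable_inverse_1_plus_square by (simp add: set_integrable_def)

text \<open>Trades exponential decay for 1 / (1 + t^2), a majorant integrable on the whole line that
  serves in the time domain and on vertical lines alike.\<close>

lemma exp_minus_le_inverse_square: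
  fixes t :: real
  assumes "t \<ge> 0"
  shows "exp (- t) \<le> 2 * inverse (1 + t^2)"
proof -
  have "(1 + t^2) / 2 \<le> exp t" using exp_lower_Taylor_quadratic[OF assms] assms by simp
  then have "inverse (exp t) \<le> inverse ((1 + t^2) / 2)"
    by (intro le_imp_inverse_le) (auto simp: add_pos_nonneg)
  then show ?thesis by (simp only: exp_minus inverse_divide) (simp add: divide_inverse)
qed

text \<open>Continuity on the whole line together with vanishing up to time 0 makes the full-line
  transform agree with the one-sided one, so that neither derivatives nor delays produce terms from
  initial data.\<close>

definition causal :: "real \<Rightarrow> real \<Rightarrow> (real \<Rightarrow> complex) \<Rightarrow> bool" where
  "causal K c h \<longleftrightarrow> continuous_on UNIV h \<and> (\<forall>t\<le>0. h t = 0) \<and> (\<forall>t\<ge>0. norm (h t) \<le> K * exp (c * t))"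

definition laplace :: "complex \<Rightarrow> (real \<Rightarrow> complex) \<Rightarrow> complex" where
  "laplace s h = (\<integral>t. exp (- s * of_real t) * h t \<partial>lborel)"

text \<open>The line Re s = c + 1 lies one unit to the right of the growth rate, which leaves a
  factor exp (-t).\<close>

lemma causal_bound:
  assumes h: "causal K c h" and K: "K \<ge> 0" and s: "Re s = c + 1"
  shows "norm (exp (- s * of_real t) * h t) \<le> 2 * K * inverse (1 + t^2)"
proof (cases "t \<ge> 0")
  case True
  have "norm (exp (- s * of_real t)) = exp (- (c + 1) * t)" by (simp add: s algebra_simps)
  moreover have "norm (h t) \<le> K * exp (c * t)" using h True by (simp add: causal_def)
  ultimately have "norm (exp (- s * of_real t) * h t) \<le> exp (- (c + 1) * t) * (K * exp (c * t))"
    by (simp add: norm_mult)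
  also have "\<dots> = K * exp (- t)" by (simp add: exp_add[symmetric] algebra_simps mult_exp_exp)
  also have "\<dots> \<le> K * (2 * inverse (1 + t^2))"
    using K exp_minus_le_inverse_square[OF True] by (intro mult_left_mono)
  finally show ?thesis by simp
next
  case False
  then have "h t = 0" using h by (auto simp: causal_def)
  then show ?thesis using K by (simp add: add_nonneg_nonneg)
qed

lemma causal_laplace_integrable:
  assumes h: "causal K c h" and K: "K \<ge> 0" and s: "Re s = c + 1"
  shows "integrable lborel (\<lambda>t. exp (- s * of_real t) * h t)"
proof (rule Bochner_Integration.integrable_bound)
  show "integrable lborel (\<lambda>t. 2 * K * inverse (1 + t^2))"
    using integrable_inverse_square by (rule integrable_mult_right)
  have "continuous_on UNIV (\<lambda>t. exp (- s * of_real t) * h t)"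
    using h unfolding causal_def by (intro continuous_intros) auto
  then show "(\<lambda>t. exp (- s * of_real t) * h t) \<in> borel_measurable lborel"
    by (simp add: borel_measurable_continuous_onI)
  show "AE t in lborel. norm (exp (- s * of_real t) * h t) \<le> norm (2 * K * inverse (1 + t^2))"
    using causal_bound[OF h K s] K by (intro AE_I2) (auto simp: abs_mult add_nonneg_nonneg)
qed

lemma tendsto_inverse_square:
  "((\<lambda>t::real. B * inverse (1 + t^2)) \<longlongrightarrow> 0) at_top"
  "((\<lambda>t::real. B * inverse (1 + t^2)) \<longlongrightarrow> 0) at_bot"
  by real_asymp+

lemma causal_shift:
  assumes h: "causal K c h" and "K \<ge> 0" "c \<ge> 0" "\<tau> \<ge> 0"
  shows "causal K c (\<lambda>t. h (t - \<tau>))"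
  unfolding causal_def
proof (intro conjI allI impI)
  show "continuous_on UNIV (\<lambda>t. h (t - \<tau>))"
    using h unfolding causal_def by (auto intro!: continuous_on_compose2[of UNIV h] continuous_intros)
  show "h (t - \<tau>) = 0" if "t \<le> 0" for t using h assms that by (auto simp: causal_def)
  show "norm (h (t - \<tau>)) \<le> K * exp (c * t)" if "t \<ge> 0" for t
  proof (cases "t - \<tau> \<ge> 0")
    case True
    then have "norm (h (t - \<tau>)) \<le> K * exp (c * (t - \<tau>))" using h by (auto simp: causal_def)
    also have "\<dots> \<le> K * exp (c * t)" using assms by (intro mult_left_mono) (auto simp: mult_left_mono)
    finally show ?thesis .
  next
    case False
    then show ?thesis using h assms by (auto simp: causal_def)
  qed
qed

lemma laplace_shift: "laplace s (\<lambda>t. h (t - \<tau>)) = exp (- of_real \<tau> * s) * laplace s h"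
proof -
  have "laplace s (\<lambda>t. h (t - \<tau>)) = (\<integral>t. exp (- s * of_real (\<tau> + 1 * t)) * h ((\<tau> + 1 * t) - \<tau>) \<partial>lborel)"
    unfolding laplace_def by (subst lborel_integral_real_affine[where c = 1 and t = \<tau>]) auto
  also have "\<dots> = (\<integral>t. exp (- of_real \<tau> * s) * (exp (- s * of_real t) * h t) \<partial>lborel)"
    by (intro Bochner_Integration.integral_cong) (auto simp: algebra_simps exp_add exp_diff exp_minus divide_inverse)
  finally show ?thesis by (simp only: laplace_def integral_mult_right_zero)
qed

lemma laplace_deriv:
  assumes h: "causal K c h" "causal K c h'" and K: "K \<ge> 0" and s: "Re s = c + 1"
    and d: "\<And>t. (h has_vector_derivative h' t) (at t)"
  shows "laplace s h' = s * laplace s h"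
proof -
  let ?e = "\<lambda>t. exp (- s * of_real t)"
  have de: "(?e has_vector_derivative - s * ?e t) (at t)" for t
  proof -
    have "((\<lambda>x. exp (- s * x)) has_field_derivative - s * ?e t) (at (of_real t))"
      by (auto intro!: derivative_eq_intros)
    then show ?thesis using has_vector_derivative_real_field[of "\<lambda>x. exp (- s * x)"] by (simp add: o_def)
  qed
  note i1 = causal_laplace_integrable[OF h(1) K s] and i2 = causal_laplace_integrable[OF h(2) K s]
  have "(\<integral>t. ?e t * h' t + - s * (?e t * h t) \<partial>lborel) = 0"
  proof (rule integral_derivative_eq_0)
    show "((\<lambda>t. ?e t * h t) has_vector_derivative ?e t * h' t + - s * (?e t * h t)) (at t)" for t
      using has_vector_derivative_mult[OF de d, of t] by (simp add: algebra_simps)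
    show "continuous_on UNIV (\<lambda>t. ?e t * h' t + - s * (?e t * h t))"
      using h unfolding causal_def by (intro continuous_intros) auto
    show "integrable lborel (\<lambda>t. ?e t * h' t + - s * (?e t * h t))"
      using i1 i2 by (intro Bochner_Integration.integrable_add integrable_mult_right)
    show "((\<lambda>t. ?e t * h t) \<longlongrightarrow> 0) at_top" "((\<lambda>t. ?e t * h t) \<longlongrightarrow> 0) at_bot"
      by (rule Lim_null_comparison[OF _ tendsto_inverse_square(1)], rule always_eventually, rule allI, rule causal_bound[OF h(1) K s],
          rule Lim_null_comparison[OF _ tendsto_inverse_square(2)], rule always_eventually, rule allI, rule causal_bound[OF h(1) K s])
  qed
  moreover have "(\<integral>t. ?e t * h' t + - s * (?e t * h t) \<partial>lborel)
      = laplace s h' + - s * laplace s h"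
    unfolding laplace_def using i1 i2
    by (subst Bochner_Integration.integral_add) auto
  ultimately show ?thesis by (simp add: eq_neg_iff_add_eq_0)
qed

section \<open>Transforms of compactly supported functions and decay of causal modes\<close>

lemma truncated_laplace_holomorphic:
  fixes g :: "real \<Rightarrow> complex"
  assumes "continuous_on UNIV g"
  shows "(\<lambda>s. integral {a..b} (\<lambda>t. exp (- s * of_real t) * g t)) holomorphic_on UNIV"
  unfolding cbox_interval[symmetric]
proof (rule leibniz_rule_holomorphic)
  show "((\<lambda>s. exp (- s * of_real t) * g t) has_field_derivative - of_real t * exp (- s * of_real t) * g t) (at s within UNIV)" for s t
    by (auto intro!: derivative_eq_intros)
  show "(\<lambda>t. exp (- s * of_real t) * g t) integrable_on cbox a b" for s
    by (intro integrable_continuous continuous_intros continuous_on_subset[OF assms]) auto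
  show "continuous_on (UNIV \<times> cbox a b) (\<lambda>(s, t). - of_real t * exp (- s * of_real t) * g t)"
    unfolding split_def
    by (intro continuous_intros continuous_on_compose2[OF assms]) auto
qed auto

lemma truncated_laplace_bounded:
  fixes g :: "real \<Rightarrow> complex"
  assumes g: "continuous_on UNIV g" and T: "T \<ge> 0"
  obtains B where "B \<ge> 0" "\<And>s. \<bar>Re s\<bar> \<le> c \<Longrightarrow> norm (integral {0..T} (\<lambda>t. exp (- s * of_real t) * g t)) \<le> B"
proof -
  have "compact (g ` {0..T})" by (intro compact_continuous_image continuous_on_subset[OF g]) auto
  then obtain b where b: "\<And>t. t \<in> {0..T} \<Longrightarrow> norm (g t) \<le> b"
    by (meson bounded_iff compact_imp_bounded imageI)
  have b0: "b \<ge> 0" using b[of 0] T norm_ge_zero[of "g 0"] by (meson atLeastAtMost_iff order_refl order_trans)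
  show ?thesis
  proof (rule that[of "exp (c * T) * b * (T - 0)"])
    fix s assume s: "\<bar>Re s\<bar> \<le> c"
    show "norm (integral {0..T} (\<lambda>t. exp (- s * of_real t) * g t)) \<le> exp (c * T) * b * (T - 0)"
    proof (rule integral_bound)
      fix t assume t: "t \<in> {0..T}"
      have "- Re s * t \<le> c * T" using s t by (intro mult_mono) auto
      then have "norm (exp (- s * of_real t)) \<le> exp (c * T)" by simp
      then show "norm (exp (- s * of_real t) * g t) \<le> exp (c * T) * b"
        unfolding norm_mult using b[OF t] by (intro mult_mono) auto
    qed (use T g in \<open>auto intro!: continuous_intros intro: continuous_on_subset\<close>)
  qed (use b0 T in auto)
qed

lemma laplace_compact_support:
  fixes g :: "real \<Rightarrow> complex"
  assumes g: "continuous_on UNIV g" and z: "\<And>t. t \<le> 0 \<Longrightarrow> g t = 0" "\<And>t. t \<ge> T \<Longrightarrow> g t = 0"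
  shows "laplace s g = integral {0..T} (\<lambda>t. exp (- s * of_real t) * g t)"
proof -
  have c: "continuous_on {0..T} (\<lambda>t. exp (- s * of_real t) * g t)"
    by (intro continuous_intros continuous_on_subset[OF g]) auto
  have "laplace s g = (\<integral>t\<in>{0..T}. exp (- s * of_real t) * g t \<partial>lborel)"
    unfolding laplace_def set_lebesgue_integral_def
    by (intro Bochner_Integration.integral_cong) (use z in \<open>auto simp: indicator_def not_le\<close>)
  also have "\<dots> = integral {0..T} (\<lambda>t. exp (- s * of_real t) * g t)"
    by (intro set_borel_integral_eq_integral borel_integrable_atLeastAtMost')
       (use c in auto)
  finally show ?thesis .
qed

lemma delay_mode_decay:
  fixes z z1 z2 :: "real \<Rightarrow> complex"
  assumes dz: "\<And>t. (z has_vector_derivative z1 t) (at t)" "\<And>t. (z1 has_vector_derivative z2 t) (at t)"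
    and causal: "causal K c z" "causal K c z1" "causal K c z2"
    and K: "K \<ge> 0" and c: "c \<ge> 0" and T: "T \<ge> 0"
    and eq: "\<And>t. t \<ge> T \<Longrightarrow> z2 t + of_real l * (of_real k1 * z (t - \<tau>) + of_real k2 * z1 (t - \<tau>)) = 0"
    and nz: "\<And>s. Re s \<ge> 0 \<Longrightarrow> char_fun l k1 k2 \<tau> s \<noteq> 0"
    and pos: "l \<ge> 0" "k1 \<ge> 0" "k2 \<ge> 0" "\<tau> \<ge> 0"
  obtains C \<delta> where "\<delta> > 0" "\<And>t. norm (z t) \<le> C * exp (- \<delta> * t)"
proof -
  \<comment> \<open>The defect of the delay equation. It vanishes for t <= 0 by causality and from T
    on by \<open>eq\<close>, so its transform \<open>gh\<close> is an integral over [0, T].\<close>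
  define g where "g = (\<lambda>t. z2 t + of_real l * (of_real k1 * z (t - \<tau>) + of_real k2 * z1 (t - \<tau>)))"
  define gh where "gh = (\<lambda>s. integral {0..T} (\<lambda>t. exp (- s * of_real t) * g t))"
  define H where "H = (\<lambda>s. gh s / char_fun l k1 k2 \<tau> s)"
  note sh = causal_shift[OF causal(1) K c pos(4)] causal_shift[OF causal(2) K c pos(4)]
  have gcont: "continuous_on UNIV g"
    using sh causal unfolding g_def causal_def by (intro continuous_intros) auto
  have lap_g: "laplace s g = gh s" for s
    unfolding gh_def
  proof (rule laplace_compact_support[OF gcont])
    show "g t = 0" if "t \<le> 0" for t using sh causal that by (auto simp: g_def causal_def)
    show "g t = 0" if "t \<ge> T" for t using eq[OF that] by (simp add: g_def)
  qed
  have lap_z: "laplace s z = H s" if s: "Re s = c + 1" for s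
  proof -
    note i = causal_laplace_integrable[OF causal(3) K s] causal_laplace_integrable[OF sh(1) K s]
      causal_laplace_integrable[OF sh(2) K s]
    have "gh s = (\<integral>t. exp (- s * of_real t) * z2 t + of_real l * (of_real k1 * (exp (- s * of_real t) * z (t - \<tau>))
        + of_real k2 * (exp (- s * of_real t) * z1 (t - \<tau>))) \<partial>lborel)"
      unfolding lap_g[symmetric] laplace_def g_def
      by (intro Bochner_Integration.integral_cong) (auto simp: algebra_simps)
    also have "\<dots> = laplace s z2 + of_real l * (of_real k1 * laplace s (\<lambda>t. z (t - \<tau>)) + of_real k2 * laplace s (\<lambda>t. z1 (t - \<tau>)))"
      unfolding laplace_def using i
      by (simp only: Bochner_Integration.integral_add integral_mult_right_zero
          Bochner_Integration.integrable_add integrable_mult_right)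
    also have "laplace s z2 = s * laplace s z1" by (rule laplace_deriv[OF causal(2,3) K s dz(2)])
    also have "laplace s z1 = s * laplace s z" by (rule laplace_deriv[OF causal(1,2) K s dz(1)])
    also have "s * (s * laplace s z) + of_real l * (of_real k1 * laplace s (\<lambda>t. z (t - \<tau>)) + of_real k2 * laplace s (\<lambda>t. z1 (t - \<tau>)))
       = char_fun l k1 k2 \<tau> s * laplace s z"
      unfolding laplace_shift laplace_deriv[OF causal(1,2) K s dz(1)] char_fun_def
      by (simp add: algebra_simps power2_eq_square)
    finally show ?thesis using nz[of s] s c by (simp add: H_def)
  qed
  \<comment> \<open>The right edge c + 2 puts the inversion line Re s = c + 1 into the interior of
    the strip.\<close>
  obtain \<delta>0 m where dm: "0 < \<delta>0" "\<delta>0 \<le> 1" "0 < m"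
    "\<And>s. - \<delta>0 \<le> Re s \<Longrightarrow> Re s \<le> c + 2 \<Longrightarrow> m * (1 + (Im s)\<^sup>2) \<le> cmod (char_fun l k1 k2 \<tau> s)"
    using char_fun_lower_bound_strip[of l k1 k2 \<tau> "c + 2"] nz pos c by (metis add_nonneg_nonneg zero_le_numeral)
  obtain B where B: "B \<ge> 0" "\<And>s. \<bar>Re s\<bar> \<le> c + 2 \<Longrightarrow> norm (gh s) \<le> B"
    using truncated_laplace_bounded[OF gcont T, of "c + 2"] unfolding gh_def by blast
  define S where "S = {s. - \<delta>0 < Re s \<and> Re s < c + 2}"
  have S: "open S" "convex S"
  proof -
    have "S = {s. - \<delta>0 < Re s} \<inter> {s. Re s < c + 2}" by (auto simp: S_def)
    then show "open S" "convex S"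
      by (simp_all add: open_Int open_halfspace_Re_gt open_halfspace_Re_lt convex_Int convex_halfspace_Re_gt convex_halfspace_Re_lt)
  qed
  have chS: "char_fun l k1 k2 \<tau> s \<noteq> 0" if "s \<in> S" for s
  proof -
    have "0 < m * (1 + (Im s)\<^sup>2)" using dm(3) by (intro mult_pos_pos add_pos_nonneg) auto
    also have "\<dots> \<le> cmod (char_fun l k1 k2 \<tau> s)" using dm(4)[of s] that by (auto simp: S_def)
    finally show ?thesis by auto
  qed
  have Hbd: "norm (H s) \<le> (B / m) * inverse (1 + (Im s)^2)" if "s \<in> S" for s
  proof -
    have p: "0 < m * (1 + (Im s)\<^sup>2)" using dm(3) by (intro mult_pos_pos add_pos_nonneg) auto
    have "norm (H s) \<le> B / (m * (1 + (Im s)\<^sup>2))"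
      unfolding H_def norm_divide
      using B(1) B(2)[of s] dm(2) dm(4)[of s] that p c
      by (intro frac_le) (auto simp: S_def)
    then show ?thesis by (simp add: divide_inverse)
  qed
  have Hhol: "H holomorphic_on S"
    unfolding H_def gh_def
  proof (intro holomorphic_on_divide)
    show "(\<lambda>s. integral {0..T} (\<lambda>t. exp (- s * of_real t) * g t)) holomorphic_on S"
      using truncated_laplace_holomorphic[OF gcont] by (rule holomorphic_on_subset) auto
    show "char_fun l k1 k2 \<tau> holomorphic_on S"
      unfolding char_fun_def by (intro holomorphic_intros)
  qed (use chS in auto)
  have lineS: "Complex \<sigma> w \<in> S" if "- \<delta>0 < \<sigma>" "\<sigma> < c + 2" for \<sigma> w using that by (simp add: S_def)
  have contline: "continuous_on UNIV (\<lambda>w. H (Complex \<sigma> w) * exp (Complex \<sigma> w * of_real t))"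
    if "- \<delta>0 < \<sigma>" "\<sigma> < c + 2" for \<sigma> t
  proof (intro continuous_intros)
    have "continuous_on UNIV (\<lambda>w. Complex \<sigma> w)" unfolding Complex_eq by (intro continuous_intros)
    moreover have "Complex \<sigma> ` UNIV \<subseteq> S" using lineS[OF that] by blast
    ultimately show "continuous_on UNIV (\<lambda>w. H (Complex \<sigma> w))"
      by (rule continuous_on_compose2[OF holomorphic_on_imp_continuous_on[OF Hhol]])
  qed
  have bdline: "norm (H (Complex \<sigma> w) * exp (Complex \<sigma> w * of_real t)) \<le> (B / m * exp (\<sigma> * t)) * inverse (1 + w^2)"
    if "- \<delta>0 < \<sigma>" "\<sigma> < c + 2" for \<sigma> w t
    using mult_right_mono[OF Hbd[OF lineS[OF that, of w]], of "exp (\<sigma> * t)"] by (simp add: norm_mult algebra_simps)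
  have intline: "integrable lborel (\<lambda>w. H (Complex \<sigma> w) * exp (Complex \<sigma> w * of_real t))"
    if "- \<delta>0 < \<sigma>" "\<sigma> < c + 2" for \<sigma> t
  proof (rule Bochner_Integration.integrable_bound)
    show "integrable lborel (\<lambda>w. (B / m * exp (\<sigma> * t)) * inverse (1 + w^2))"
      using integrable_inverse_square by (rule integrable_mult_right)
    show "(\<lambda>w. H (Complex \<sigma> w) * exp (Complex \<sigma> w * of_real t)) \<in> borel_measurable lborel"
      using contline[OF that] by (simp add: borel_measurable_continuous_onI)
    show "AE w in lborel. norm (H (Complex \<sigma> w) * exp (Complex \<sigma> w * of_real t))
        \<le> norm ((B / m * exp (\<sigma> * t)) * inverse (1 + w^2))"
      using bdline[OF that] by (intro AE_I2) (metis abs_ge_self order_trans real_norm_def)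
  qed
  \<comment> \<open>\<open>z\<close> is recovered from its transform \<open>H\<close> on the line \<open>Re s = c + 1\<close>, and the line of integration is then
    moved to \<open>Re s = \<sigma> < 0\<close>.\<close>
  define \<sigma> where "\<sigma> = - \<delta>0 / 2"
  have \<sigma>: "- \<delta>0 < \<sigma>" "\<sigma> < c + 2" "\<sigma> < 0" "\<sigma> < c + 1" using dm(1) c by (auto simp: \<sigma>_def)
  have c1: "- \<delta>0 < c + 1" "c + 1 < c + 2" using dm(1) c by auto
  have inversion: "(\<integral>w. H (Complex (c + 1) w) * exp (Complex (c + 1) w * of_real t) \<partial>lborel) = of_real (2 * pi) * z t" for t
  proof -
    \<comment> \<open>Damping \<open>z\<close> by exp (- (c + 1) u) makes the transform on the line
      Re s = c + 1 a Fourier transform.\<close>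
    let ?f = "\<lambda>u. exp (- of_real (c + 1) * of_real u) * z u"
    have "(\<integral>w. H (Complex (c + 1) w) * iexp (w * t) \<partial>lborel) = of_real (2 * pi) * ?f t"
    proof (rule fourier_inversion)
      show "continuous_on UNIV ?f" using causal unfolding causal_def by (intro continuous_intros) auto
      show "norm (?f u) \<le> 2 * K" for u
      proof -
        have "norm (?f u) \<le> 2 * K * inverse (1 + u^2)"
          using causal_bound[OF causal(1) K, of "of_real (c+1)" u] by simp
        also have "\<dots> \<le> 2 * K * 1" using K by (intro mult_left_mono) (auto simp: inverse_le_1_iff)
        finally show ?thesis by simp
      qed
      show "integrable lborel ?f"
        using causal_laplace_integrable[OF causal(1) K, of "of_real (c+1)"] by simp
      show "H (Complex (c + 1) w) = (\<integral>u. ?f u * iexp (- (w * u)) \<partial>lborel)" for w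
      proof -
        have "H (Complex (c + 1) w) = laplace (Complex (c + 1) w) z"
          by (rule lap_z[symmetric]) simp
        also have "\<dots> = (\<integral>u. ?f u * iexp (- (w * u)) \<partial>lborel)"
          unfolding laplace_def
          by (intro Bochner_Integration.integral_cong)
             (auto simp: Complex_eq algebra_simps exp_add exp_diff exp_minus divide_inverse)
        finally show ?thesis .
      qed
      show "integrable lborel (\<lambda>w. H (Complex (c + 1) w))" using intline[OF c1, of 0] by simp
    qed
    then have "exp (of_real ((c + 1) * t)) * (\<integral>w. H (Complex (c + 1) w) * iexp (w * t) \<partial>lborel)
       = of_real (2 * pi) * (exp (of_real ((c + 1) * t)) * ?f t)" by simp
    also have "exp (of_real ((c + 1) * t)) * ?f t = z t"
    proof -
      have "exp (of_real ((c + 1) * t)) * exp (- of_real (c + 1) * of_real t) = (1::complex)"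
        unfolding exp_add[symmetric] by (simp add: algebra_simps)
      then show ?thesis by (simp only: mult.assoc[symmetric] mult_1)
    qed
    also have "exp (of_real ((c + 1) * t)) * (\<integral>w. H (Complex (c + 1) w) * iexp (w * t) \<partial>lborel)
       = (\<integral>w. exp (of_real ((c + 1) * t)) * (H (Complex (c + 1) w) * iexp (w * t)) \<partial>lborel)"
      by (rule integral_mult_right_zero[symmetric])
    also have "\<dots> = (\<integral>w. H (Complex (c + 1) w) * exp (Complex (c + 1) w * of_real t) \<partial>lborel)"
      by (intro Bochner_Integration.integral_cong) (auto simp: Complex_eq algebra_simps exp_add)
    finally show ?thesis .
  qed
  have shift: "(\<integral>w. H (Complex (c + 1) w) * exp (Complex (c + 1) w * of_real t) \<partial>lborel)
    = (\<integral>w. H (Complex \<sigma> w) * exp (Complex \<sigma> w * of_real t) \<partial>lborel)" for t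
  proof -
    let ?h = "\<lambda>s. H s * exp (s * of_real t)"
    \<comment> \<open>A primitive on the convex strip replaces rectangular contours. Its difference
      between the two lines is an integral over a horizontal segment of fixed length, where the
      integrand is O(1 / (1 + w^2)); it tends to 0 at both ends, so its derivative in w integrates
      to 0.\<close>
    have "?h holomorphic_on S" using Hhol by (intro holomorphic_intros)
    then obtain P where P: "\<And>s. s \<in> S \<Longrightarrow> (P has_field_derivative ?h s) (at s within S)"
      using holomorphic_convex_primitive'[OF S(2,1)] by blast
    have line: "((\<lambda>w. P (Complex a w)) has_vector_derivative \<i> * ?h (Complex a w)) (at w)"
      if "- \<delta>0 < a" "a < c + 2" for a w
    proof -
      have "((\<lambda>w. Complex a w) has_vector_derivative \<i>) (at w)"
        unfolding Complex_eq by (auto intro!: derivative_eq_intros simp: has_vector_derivative_def scaleR_conv_of_real mult.commute)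
      moreover have "(P has_field_derivative ?h (Complex a w)) (at (Complex a w))"
        using P[OF lineS[OF that]] at_within_open[OF lineS[OF that] S(1)] by simp
      ultimately show ?thesis
        using field_vector_diff_chain_at[of "Complex a" \<i> w P] by (simp add: o_def)
    qed
    have Dbd: "norm (P (Complex (c + 1) w) - P (Complex \<sigma> w)) \<le> (B / m * exp ((c + 1) * \<bar>t\<bar>) * (c + 1 - \<sigma>)) * inverse (1 + w^2)" for w
    proof -
      let ?L = "closed_segment (Complex \<sigma> w) (Complex (c + 1) w)"
      have Ls: "Im s = w \<and> \<sigma> \<le> Re s \<and> Re s \<le> c + 1" if "s \<in> ?L" for s
        using that \<sigma> by (auto simp: closed_segment_same_Im closed_segment_eq_real_ivl)
      have "?L \<subseteq> S" using Ls \<sigma> by (fastforce simp: S_def)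
      have "norm (P (Complex (c + 1) w) - P (Complex \<sigma> w))
          \<le> (B / m * exp ((c + 1) * \<bar>t\<bar>) * inverse (1 + w^2)) * norm (Complex (c + 1) w - Complex \<sigma> w)"
      proof (rule field_differentiable_bound[of ?L P ?h])
        fix s assume s: "s \<in> ?L"
        show "(P has_field_derivative ?h s) (at s within ?L)"
          using P[of s] s \<open>?L \<subseteq> S\<close> by (meson DERIV_subset subsetD)
        have "\<bar>Re s\<bar> \<le> c + 1" using Ls[OF s] \<sigma>(1) dm(2) c by linarith
        then have "Re s * t \<le> (c + 1) * \<bar>t\<bar>"
          by (metis abs_ge_self abs_ge_zero abs_mult mult_right_mono order_trans)
        then have "norm (exp (s * of_real t)) \<le> exp ((c + 1) * \<bar>t\<bar>)" by simp
        then have "norm (?h s) \<le> ((B / m) * inverse (1 + (Im s)^2)) * exp ((c + 1) * \<bar>t\<bar>)"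
          unfolding norm_mult using Hbd[of s] s \<open>?L \<subseteq> S\<close> B(1) dm(3)
          by (intro mult_mono) (auto intro!: mult_nonneg_nonneg simp: add_nonneg_nonneg)
        then show "norm (?h s) \<le> B / m * exp ((c + 1) * \<bar>t\<bar>) * inverse (1 + w^2)"
          using Ls[OF s] by (simp add: algebra_simps)
      qed auto
      also have "norm (Complex (c + 1) w - Complex \<sigma> w) = c + 1 - \<sigma>"
      proof -
        have "Complex (c + 1) w - Complex \<sigma> w = of_real (c + 1 - \<sigma>)" by (simp add: complex_eq_iff)
        then show ?thesis using \<sigma> by (simp only: norm_of_real)
      qed
      finally show ?thesis by (simp add: algebra_simps)
    qed
    have "(\<integral>w. \<i> * ?h (Complex (c + 1) w) - \<i> * ?h (Complex \<sigma> w) \<partial>lborel) = 0"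
    proof (rule integral_derivative_eq_0)
      show "((\<lambda>w. P (Complex (c + 1) w) - P (Complex \<sigma> w)) has_vector_derivative
          \<i> * ?h (Complex (c + 1) w) - \<i> * ?h (Complex \<sigma> w)) (at w)" for w
        by (intro has_vector_derivative_diff line c1 \<sigma>)
      show "continuous_on UNIV (\<lambda>w. \<i> * ?h (Complex (c + 1) w) - \<i> * ?h (Complex \<sigma> w))"
        by (intro continuous_on_diff continuous_on_mult_left contline c1 \<sigma>)
      show "integrable lborel (\<lambda>w. \<i> * ?h (Complex (c + 1) w) - \<i> * ?h (Complex \<sigma> w))"
        by (intro Bochner_Integration.integrable_diff integrable_mult_right intline c1 \<sigma>)
      show "((\<lambda>w. P (Complex (c + 1) w) - P (Complex \<sigma> w)) \<longlongrightarrow> 0) at_top"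
        by (rule Lim_null_comparison[OF _ tendsto_inverse_square(1)], rule always_eventually, rule allI, rule Dbd)
      show "((\<lambda>w. P (Complex (c + 1) w) - P (Complex \<sigma> w)) \<longlongrightarrow> 0) at_bot"
        by (rule Lim_null_comparison[OF _ tendsto_inverse_square(2)], rule always_eventually, rule allI, rule Dbd)
    qed
    also have "(\<integral>w. \<i> * ?h (Complex (c + 1) w) - \<i> * ?h (Complex \<sigma> w) \<partial>lborel)
      = \<i> * (\<integral>w. ?h (Complex (c + 1) w) \<partial>lborel) - \<i> * (\<integral>w. ?h (Complex \<sigma> w) \<partial>lborel)"
      using intline[OF c1, of t] intline[OF \<sigma>(1,2), of t]
      by (simp only: Bochner_Integration.integral_diff integrable_mult_right integral_mult_right_zero)
    finally show ?thesis by simp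
  qed
  define J where "J = (\<integral>w. inverse (1 + w^2 :: real) \<partial>lborel)"
  show ?thesis
  proof (rule that[of "- \<sigma>" "B / m * J / (2 * pi)"])
    show "- \<sigma> > 0" using \<sigma> by simp
    fix t
    have "2 * pi * norm (z t) = norm (\<integral>w. H (Complex \<sigma> w) * exp (Complex \<sigma> w * of_real t) \<partial>lborel)"
      using inversion[of t] unfolding shift by (simp add: norm_mult)
    also have "\<dots> \<le> (\<integral>w. (B / m * exp (\<sigma> * t)) * inverse (1 + w^2) \<partial>lborel)"
      using bdline[OF \<sigma>(1,2), of _ t] intline[OF \<sigma>(1,2), of t] integrable_inverse_square
      by (intro Bochner_Integration.integral_norm_bound_integral integrable_mult_right) auto
    also have "\<dots> = B / m * exp (\<sigma> * t) * J" by (simp only: integral_mult_right_zero J_def)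
    finally have "norm (z t) * (2 * pi) \<le> B / m * exp (\<sigma> * t) * J" by (simp add: mult.commute)
    then have "norm (z t) \<le> B / m * exp (\<sigma> * t) * J / (2 * pi)" by (subst pos_le_divide_eq) auto
    then show "norm (z t) \<le> B / m * J / (2 * pi) * exp (- (- \<sigma>) * t)" by (simp add: mult_ac)
  qed
qed

section \<open>Decay of a delayed mode\<close>

lemma power2_pos_part_deriv: "((\<lambda>t::real. (max 0 t)^2) has_real_derivative 2 * max 0 t) (at t)"
proof (cases "t = 0")
  case True
  have "((\<lambda>h::real. (max 0 h)^2 / h) \<longlongrightarrow> 0) (at 0)"
  proof (rule Lim_null_comparison)
    show "\<forall>\<^sub>F h in at (0::real). norm ((max 0 h)^2 / h) \<le> \<bar>h\<bar>"
      by (auto intro!: always_eventually simp: max_def power2_eq_square)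
    show "((\<lambda>h. \<bar>h\<bar>) \<longlongrightarrow> 0) (at (0::real))" by (rule tendsto_rabs_zero) (rule tendsto_ident_at)
  qed
  then show ?thesis using True by (simp add: DERIV_def)
next
  case False
  then consider "t > 0" | "t < 0" by linarith
  then show ?thesis
  proof cases
    case 1
    have "((\<lambda>t::real. t^2) has_real_derivative 2 * max 0 t) (at t)"
      using 1 by (auto intro!: derivative_eq_intros)
    then show ?thesis
      by (rule has_field_derivative_transform_within_open[of _ _ _ "{0<..}"]) (use 1 in auto)
  next
    case 2
    have "((\<lambda>t::real. 0) has_real_derivative 2 * max 0 t) (at t)" using 2 by auto
    then show ?thesis
      by (rule has_field_derivative_transform_within_open[of _ _ _ "{..<0}"]) (use 2 in auto)
  qed
qed

lemma power3_pos_part_deriv: "((\<lambda>t::real. (max 0 t)^3) has_real_derivative 3 * (max 0 t)^2) (at t)"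
proof -
  have "(\<lambda>t::real. (max 0 t)^3) = (\<lambda>t. t * (max 0 t)^2)"
    by (auto simp: max_def power2_eq_square power3_eq_cube)
  moreover have "((\<lambda>t::real. t * (max 0 t)^2) has_real_derivative 1 * (max 0 t)^2 + 2 * max 0 t * t) (at t)"
    by (rule DERIV_mult[OF DERIV_ident power2_pos_part_deriv])
  moreover have "1 * (max 0 t)^2 + 2 * max 0 t * t = 3 * (max 0 t)^2"
    by (auto simp: max_def power2_eq_square)
  ultimately show ?thesis by (simp only:)
qed

lemma C2_cutoff:
  obtains \<psi> \<psi>1 \<psi>2 :: "real \<Rightarrow> real" and b where
    "\<And>t. (\<psi> has_real_derivative \<psi>1 t) (at t)" "\<And>t. (\<psi>1 has_real_derivative \<psi>2 t) (at t)"
    "continuous_on UNIV \<psi>2"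
    "\<And>t. t \<le> 0 \<Longrightarrow> \<psi> t = 0 \<and> \<psi>1 t = 0 \<and> \<psi>2 t = 0"
    "\<And>t. t \<ge> 3 \<Longrightarrow> \<psi> t = 1 \<and> \<psi>1 t = 0 \<and> \<psi>2 t = 0"
    "\<And>t. \<bar>\<psi> t\<bar> \<le> b \<and> \<bar>\<psi>1 t\<bar> \<le> b \<and> \<bar>\<psi>2 t\<bar> \<le> b"
proof -
  \<comment> \<open>The cutoff is the integral of the quadratic B-spline, that is, the third difference of
    \<open>max 0 t ^ 3 / 6\<close>.\<close>
  define S :: "(real \<Rightarrow> real) \<Rightarrow> real \<Rightarrow> real"
    where "S f t = (f t - 3 * f (t - 1) + 3 * f (t - 2) - f (t - 3)) / 6" for f t
  define p where "p k t = (max 0 t)^k" for k :: nat and t :: real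
  have S_deriv: "(S f has_real_derivative S f' t) (at t)"
    if f: "\<And>t. (f has_real_derivative f' t) (at t)" for f f' t
  proof -
    have sh: "((\<lambda>t. f (t - a)) has_real_derivative f' (t - a)) (at t)" for a
    proof -
      have "((\<lambda>t. t - a) has_real_derivative 1) (at t)" by (auto intro!: derivative_eq_intros)
      from DERIV_chain2[OF f this] show ?thesis by simp
    qed
    show ?thesis unfolding S_def[abs_def]
      by (intro DERIV_cdivide DERIV_diff DERIV_add DERIV_cmult f sh)
  qed
  define \<psi> \<psi>1 \<psi>2 where "\<psi> = S (p 3)" and "\<psi>1 = S (\<lambda>t. 3 * p 2 t)" and "\<psi>2 = S (\<lambda>t. 3 * (2 * p 1 t))"
  have d1: "(\<psi> has_real_derivative \<psi>1 t) (at t)" for t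
    unfolding \<psi>_def \<psi>1_def
    by (intro S_deriv) (unfold p_def[abs_def], rule power3_pos_part_deriv)
  have d2: "(\<psi>1 has_real_derivative \<psi>2 t) (at t)" for t
    unfolding \<psi>1_def \<psi>2_def
    by (intro S_deriv DERIV_cmult) (unfold p_def[abs_def] power_one_right, rule power2_pos_part_deriv)
  have c2: "continuous_on A \<psi>2" for A
    unfolding \<psi>2_def S_def[abs_def] p_def[abs_def] by (intro continuous_intros) auto
  have c1: "continuous_on A \<psi>1" "continuous_on A \<psi>" for A
    using d1 d2 by (meson DERIV_isCont continuous_at_imp_continuous_on)+
  have z0: "\<psi> t = 0 \<and> \<psi>1 t = 0 \<and> \<psi>2 t = 0" if "t \<le> 0" for t
    using that by (simp add: \<psi>_def \<psi>1_def \<psi>2_def S_def p_def)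
  \<comment> \<open>Beyond the last knot 3 every truncated power is an ordinary polynomial; the
    third difference of t^3 / 6 is 1, and that of lower powers is 0.\<close>
  have z3: "\<psi> t = 1 \<and> \<psi>1 t = 0 \<and> \<psi>2 t = 0" if "t \<ge> 3" for t
    using that by (simp add: \<psi>_def \<psi>1_def \<psi>2_def S_def p_def power3_eq_cube power2_eq_square algebra_simps)
  have "\<exists>b. \<forall>t. \<bar>f t\<bar> \<le> b" if c: "continuous_on {0..3} f" and o: "\<And>t. t \<le> 0 \<or> t \<ge> 3 \<Longrightarrow> \<bar>f t\<bar> \<le> 1"
    for f :: "real \<Rightarrow> real"
  proof -
    have "compact (f ` {0..3})" using c by (intro compact_continuous_image) auto
    then obtain b where b: "\<And>t. t \<in> {0..3} \<Longrightarrow> \<bar>f t\<bar> \<le> b"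
      by (metis bounded_iff compact_imp_bounded imageI real_norm_def)
    have "\<bar>f t\<bar> \<le> max 1 b" for t
      using b[of t] o[of t] by (cases "t \<in> {0..3}") (auto simp: max_def)
    then show ?thesis by blast
  qed
  note bd = this
  obtain b0 where b0: "\<And>t. \<bar>\<psi> t\<bar> \<le> b0" using bd[of \<psi>] c1 z0 z3 by fastforce
  obtain b1 where b1: "\<And>t. \<bar>\<psi>1 t\<bar> \<le> b1" using bd[of \<psi>1] c1 z0 z3 by fastforce
  obtain b2 where b2: "\<And>t. \<bar>\<psi>2 t\<bar> \<le> b2" using bd[of \<psi>2] c2 z0 z3 by fastforce
  show ?thesis
    by (rule that[OF d1 d2 c2 z0 z3, of "max b0 (max b1 b2)"]) (use b0 b1 b2 in \<open>auto simp: le_max_iff_disj\<close>)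
qed

text \<open>The velocity \<open>w\<close> is a separate function because on the history it is only
  continuous, and at time 0 its derivative is one-sided. Values are complex since the eigenvectors
  that produce modes are.\<close>

definition delay_mode :: "real \<Rightarrow> real \<Rightarrow> real \<Rightarrow> real \<Rightarrow> (real \<Rightarrow> complex) \<Rightarrow> (real \<Rightarrow> complex) \<Rightarrow> bool" where
  "delay_mode l k1 k2 \<tau> y w \<longleftrightarrow>
     continuous_on {-\<tau>..0} w \<and>
     (\<forall>t\<ge>-\<tau>. (y has_vector_derivative w t) (at t within {-\<tau>..})) \<and>
     (\<forall>t\<ge>0. (w has_vector_derivative
        - (of_real l * (of_real k1 * y (t - \<tau>) + of_real k2 * w (t - \<tau>)))) (at t within {0..}))"

lemma delay_mode_continuous:
  assumes m: "delay_mode l k1 k2 \<tau> y w" and tau: "\<tau> \<ge> 0"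
  shows "continuous_on {-\<tau>..} y" "continuous_on {-\<tau>..} w"
proof -
  show "continuous_on {-\<tau>..} y"
    using m has_vector_derivative_continuous unfolding delay_mode_def continuous_on_eq_continuous_within
    by (metis atLeast_iff)
  have "continuous_on {0..} w"
    using m has_vector_derivative_continuous unfolding delay_mode_def continuous_on_eq_continuous_within
    by (metis atLeast_iff)
  moreover have "continuous_on {-\<tau>..0} w" using m by (simp add: delay_mode_def)
  ultimately have "continuous_on ({-\<tau>..0} \<union> {0..}) w"
    by (intro continuous_on_closed_Un) auto
  moreover have "{-\<tau>..0} \<union> {0..} = {-\<tau>..}" using tau by auto
  ultimately show "continuous_on {-\<tau>..} w" by simp
qed

text \<open>The Laplace transform of a solution makes sense only after an a priori exponential
  bound. As the derivative at t involves time t - \<open>\<tau>\<close>, the estimate runs over a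
  weighted supremum of the whole past.\<close>

lemma delay_mode_growth:
  assumes m: "delay_mode l k1 k2 \<tau> y w" and tau: "\<tau> \<ge> 0" and pos: "l \<ge> 0" "k1 \<ge> 0" "k2 \<ge> 0"
  obtains K c where "K \<ge> 0" "c \<ge> 0" "\<And>t. t \<ge> - \<tau> \<Longrightarrow> norm (y t) + norm (w t) \<le> K * exp (c * t)"
proof -
  define W where "W t = norm (y t) + norm (w t)" for t
  define a where "a = l * (k1 + k2)"
  define c where "c = 2 * (1 + a)"
  have a: "a \<ge> 0" using pos by (simp add: a_def)
  then have c: "c > 0" by (simp add: c_def)
  \<comment> \<open>With this choice of \<open>c\<close>, integrating the equation on \<open>[0, T]\<close> bounds the supremum \<open>M\<close> of \<open>V\<close> by
    initial data plus \<open>M / 2\<close>, uniformly in \<open>T\<close>.\<close>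
  define V where "V t = exp (- c * t) * W t" for t
  note cont = delay_mode_continuous[OF m tau]
  have contV: "continuous_on {-\<tau>..T} V" for T
    unfolding V_def[abs_def] W_def[abs_def]
    by (intro continuous_intros continuous_on_subset[OF cont(1)] continuous_on_subset[OF cont(2)]) auto
  obtain h where h: "h \<in> {-\<tau>..0}" "\<And>t. t \<in> {-\<tau>..0} \<Longrightarrow> V t \<le> V h"
    using continuous_attains_sup[OF _ _ contV[of 0]] tau by auto
  define K where "K = V h + 2 * W 0"
  have K: "K \<ge> 0" by (simp add: K_def V_def W_def)
  have W0: "W t \<ge> 0" for t by (simp add: W_def)
  have WV: "W t = V t * exp (c * t)" for t by (simp add: V_def exp_minus)
  have key: "V T \<le> K" if T: "T \<ge> 0" for T
  proof -
    obtain s where s: "s \<in> {-\<tau>..T}" "\<And>t. t \<in> {-\<tau>..T} \<Longrightarrow> V t \<le> V s"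
      using continuous_attains_sup[OF _ _ contV[of T]] tau T by auto
    define M where "M = V s"
    have M: "M \<ge> 0" by (simp add: M_def V_def W_def)
    have WM: "W t \<le> M * exp (c * t)" if "t \<in> {-\<tau>..T}" for t
      unfolding WV[of t] M_def using s(2)[OF that] by (intro mult_right_mono) auto
    have Wle: "W t \<le> W 0 + M / 2 * exp (c * t)" if t: "0 \<le> t" "t \<le> T" for t
    proof (cases "t = 0")
      case True then show ?thesis using M by simp
    next
      case False
      then have t0: "0 < t" using t by simp
      have dphi: "((\<lambda>x. r * M / c * exp (c * x)) has_vector_derivative r * M * exp (c * x)) (at x)" for x r
        using c by (auto intro!: derivative_eq_intros simp: has_real_derivative_iff_has_vector_derivative[symmetric])
      have cphi: "continuous_on {0..t} (\<lambda>x. r * M / c * exp (c * x))" for r by (intro continuous_intros)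
      have y: "norm (y t - y 0) \<le> 1 * M / c * exp (c * t) - 1 * M / c * exp (c * 0)"
      proof (rule differentiable_bound_general[OF t0 _ cphi _ dphi])
        show "continuous_on {0..t} y" using tau by (intro continuous_on_subset[OF cont(1)]) auto
        fix x assume x: "0 < x" "x < t"
        have "(y has_vector_derivative w x) (at x within {-\<tau>..})" using m x tau by (simp add: delay_mode_def)
        moreover have "at x within {-\<tau>..} = at x" using x tau by (intro at_within_interior) auto
        ultimately show "(y has_vector_derivative w x) (at x)" by simp
        have "norm (w x) \<le> W x" by (simp add: W_def)
        also have "\<dots> \<le> M * exp (c * x)" using WM[of x] x t tau by simp
        finally show "norm (w x) \<le> 1 * M * exp (c * x)" by simp
      qed
      have w: "norm (w t - w 0) \<le> a * M / c * exp (c * t) - a * M / c * exp (c * 0)"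
      proof (rule differentiable_bound_general[OF t0 _ cphi _ dphi])
        show "continuous_on {0..t} w" using tau by (intro continuous_on_subset[OF cont(2)]) auto
        fix x assume x: "0 < x" "x < t"
        let ?w' = "- (of_real l * (of_real k1 * y (x - \<tau>) + of_real k2 * w (x - \<tau>)))"
        have "(w has_vector_derivative ?w') (at x within {0..})" using m x by (simp add: delay_mode_def)
        moreover have "at x within {0..} = at x" using x by (intro at_within_interior) auto
        ultimately show "(w has_vector_derivative ?w') (at x)" by simp
        have "norm (of_real k1 * y (x - \<tau>) + of_real k2 * w (x - \<tau>)) \<le> k1 * norm (y (x - \<tau>)) + k2 * norm (w (x - \<tau>))"
          using norm_triangle_ineq[of "of_real k1 * y (x - \<tau>)" "of_real k2 * w (x - \<tau>)"] pos by (simp add: norm_mult)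
        also have "\<dots> \<le> (k1 + k2) * W (x - \<tau>)"
          unfolding W_def distrib_right using pos by (intro add_mono mult_left_mono) auto
        finally have "norm ?w' \<le> l * ((k1 + k2) * W (x - \<tau>))"
          using pos by (simp add: norm_mult mult_left_mono)
        also have "\<dots> = a * W (x - \<tau>)" by (simp add: a_def)
        also have "\<dots> \<le> a * (M * exp (c * x))"
        proof (intro mult_left_mono a)
          have "W (x - \<tau>) \<le> M * exp (c * (x - \<tau>))" using WM[of "x - \<tau>"] x t tau by simp
          also have "\<dots> \<le> M * exp (c * x)" using M tau c by (intro mult_left_mono) (auto simp: mult_left_mono)
          finally show "W (x - \<tau>) \<le> M * exp (c * x)" .
        qed
        finally show "norm ?w' \<le> a * M * exp (c * x)" by simp
      qed
      have "norm (y t) \<le> norm (y 0) + norm (y t - y 0)" "norm (w t) \<le> norm (w 0) + norm (w t - w 0)"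
        by norm+
      then have "W t \<le> W 0 + (1 * M / c * exp (c * t) - 1 * M / c * exp (c * 0)) + (a * M / c * exp (c * t) - a * M / c * exp (c * 0))"
        using y w unfolding W_def by linarith
      also have "\<dots> = W 0 + (1 + a) * M / c * exp (c * t) - (1 + a) * M / c" by (simp add: algebra_simps add_divide_distrib)
      also have "(1 + a) * M / c = M / 2" using a by (simp add: c_def divide_simps)
      also have "W 0 + M / 2 * exp (c * t) - M / 2 \<le> W 0 + M / 2 * exp (c * t)" using M by simp
      finally show ?thesis .
    qed
    \<comment> \<open>If the supremum is attained at some s >= 0, evaluating \<open>Wle\<close>
      there absorbs half of M and leaves M <= 2 W 0; otherwise it is attained on the history, where
      V h bounds it.\<close>
    have "M \<le> K"
    proof (cases "s \<ge> 0")
      case True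
      have "M * exp (c * s) \<le> W 0 + M / 2 * exp (c * s)" using Wle[of s] s True WV[of s] by (simp add: M_def)
      then have "M / 2 * exp (c * s) \<le> W 0" by simp
      moreover have "M / 2 * 1 \<le> M / 2 * exp (c * s)" using M c True by (intro mult_left_mono) auto
      moreover have "V h \<ge> 0" by (simp add: V_def W_def)
      ultimately show ?thesis by (simp add: K_def)
    next
      case False
      then show ?thesis using h(2)[of s] s W0[of 0] by (simp add: M_def K_def)
    qed
    then show ?thesis using s(2)[of T] T tau by (simp add: M_def)
  qed
  show ?thesis
  proof (rule that[OF K less_imp_le[OF c]])
    fix t assume t: "t \<ge> - \<tau>"
    have "V t \<le> K"
    proof (cases "t \<ge> 0")
      case False
      then have "V t \<le> V h" using h(2)[of t] t by simp
      then show ?thesis using W0[of 0] by (simp add: K_def)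
    qed (rule key)
    then show "norm (y t) + norm (w t) \<le> K * exp (c * t)"
      unfolding W_def[symmetric] WV[of t] by (intro mult_right_mono) auto
  qed
qed

text \<open>The two descriptions overlap on (0, 1), so each point has a neighbourhood on which one
  of them holds and no one-sided derivative needs matching.\<close>

lemma has_vector_derivative_glue_zero:
  fixes f f' :: "real \<Rightarrow> 'a :: real_normed_vector"
  assumes d: "\<And>t. t > 0 \<Longrightarrow> (f has_vector_derivative f' t) (at t)"
    and z: "\<And>t. t < 1 \<Longrightarrow> f t = 0 \<and> f' t = 0"
  shows "(f has_vector_derivative f' t) (at t)"
proof (cases "t > 0")
  case False
  have "((\<lambda>_. 0) has_vector_derivative f' t) (at t)" using z[of t] False by auto
  then show ?thesis
    by (rule has_vector_derivative_transform_within_open[where S = "{..<1}"]) (use False z in auto)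
qed (rule d)

lemma continuous_glue_zero:
  fixes f :: "real \<Rightarrow> 'a :: real_normed_vector"
  assumes d: "continuous_on {0<..} f" and z: "\<And>t. t < 1 \<Longrightarrow> f t = 0"
  shows "continuous_on UNIV f"
proof -
  have "continuous_on {..<1} f" using continuous_on_cong[of "{..<1}" "{..<1}" f "\<lambda>_. 0"] z by auto
  then have "continuous_on ({..<1} \<union> {0<..}) f" using d by (intro continuous_on_open_Un) auto
  moreover have "{..<1} \<union> {0<..} = (UNIV :: real set)" by auto
  ultimately show ?thesis by simp
qed

lemma delay_mode_position_decay:
  assumes m: "delay_mode l k1 k2 \<tau> y w" and tau: "\<tau> \<ge> 0" and pos: "l \<ge> 0" "k1 \<ge> 0" "k2 \<ge> 0"
    and nz: "\<And>s. Re s \<ge> 0 \<Longrightarrow> char_fun l k1 k2 \<tau> s \<noteq> 0"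
  obtains C \<delta> where "\<delta> > 0" "C \<ge> 0" "\<And>t. t \<ge> 4 \<Longrightarrow> norm (y t) \<le> C * exp (- \<delta> * t)"
proof -
  define w' where "w' t = - (of_real l * (of_real k1 * y (t - \<tau>) + of_real k2 * w (t - \<tau>)))" for t
  obtain \<psi> \<psi>1 \<psi>2 b where
    d1: "\<And>t. (\<psi> has_real_derivative \<psi>1 t) (at t)" and d2: "\<And>t. (\<psi>1 has_real_derivative \<psi>2 t) (at t)"
    and c2: "continuous_on UNIV \<psi>2"
    and z0: "\<And>t. t \<le> 0 \<Longrightarrow> \<psi> t = 0 \<and> \<psi>1 t = 0 \<and> \<psi>2 t = 0"
    and z3: "\<And>t. t \<ge> 3 \<Longrightarrow> \<psi> t = 1 \<and> \<psi>1 t = 0 \<and> \<psi>2 t = 0"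
    and b: "\<And>t. \<bar>\<psi> t\<bar> \<le> b \<and> \<bar>\<psi>1 t\<bar> \<le> b \<and> \<bar>\<psi>2 t\<bar> \<le> b"
    using C2_cutoff by blast
  obtain K c where K: "K \<ge> 0" "c \<ge> 0" "\<And>t. t \<ge> - \<tau> \<Longrightarrow> norm (y t) + norm (w t) \<le> K * exp (c * t)"
    using delay_mode_growth[OF m tau pos] by blast
  have b0: "b \<ge> 0" using b[of 0] by linarith
  \<comment> \<open>Delaying the cutoff by 1 keeps it zero up to time 1, safely past the one-sided
    derivatives at 0; it equals 1 from time 3 + 1 = 4 on.\<close>
  define p where "p f t = f (t - 1)" for f :: "real \<Rightarrow> real" and t
  have p0: "p \<psi> t = 0" "p \<psi>1 t = 0" "p \<psi>2 t = 0" if "t \<le> 1" for t using z0[of "t - 1"] that by (auto simp: p_def)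
  have p4: "p \<psi> t = 1" "p \<psi>1 t = 0" "p \<psi>2 t = 0" if "t \<ge> 4" for t using z3[of "t - 1"] that by (auto simp: p_def)
  have pb: "\<bar>p \<psi> t\<bar> \<le> b" "\<bar>p \<psi>1 t\<bar> \<le> b" "\<bar>p \<psi>2 t\<bar> \<le> b" for t using b[of "t - 1"] by (auto simp: p_def)
  have sh: "((\<lambda>t. t - 1) has_real_derivative 1) (at t)" for t :: real by (auto intro!: derivative_eq_intros)
  have pd: "(p \<psi> has_real_derivative p \<psi>1 t) (at t)" "(p \<psi>1 has_real_derivative p \<psi>2 t) (at t)" for t
    using DERIV_chain2[OF d1 sh, of t] DERIV_chain2[OF d2 sh, of t] by (simp_all add: p_def[abs_def])
  have pc: "continuous_on A (p \<psi>)" "continuous_on A (p \<psi>1)" "continuous_on A (p \<psi>2)" for A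
  proof -
    show "continuous_on A (p \<psi>)" "continuous_on A (p \<psi>1)"
      using pd by (meson DERIV_isCont continuous_at_imp_continuous_on)+
    show "continuous_on A (p \<psi>2)" unfolding p_def[abs_def]
      by (intro continuous_on_compose2[OF c2] continuous_intros) auto
  qed
  have dy: "(y has_vector_derivative w t) (at t)" if "t > 0" for t
  proof -
    have "at t within {-\<tau>..} = at t" using that tau by (intro at_within_interior) auto
    then show ?thesis using m that tau unfolding delay_mode_def by (metis add.inverse_neutral le_imp_neg_le less_eq_real_def order_trans)
  qed
  have dw: "(w has_vector_derivative w' t) (at t)" if "t > 0" for t
  proof -
    have "at t within {0..} = at t" using that by (intro at_within_interior) auto
    then show ?thesis using m that unfolding delay_mode_def w'_def by (metis less_eq_real_def)
  qed
  note cont = delay_mode_continuous[OF m tau]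
  have cw': "continuous_on {0<..} w'"
    unfolding w'_def[abs_def] using tau
    by (intro continuous_intros continuous_on_compose2[OF cont(1)] continuous_on_compose2[OF cont(2)]) auto
  define z where "z t = p \<psi> t *\<^sub>R y t" for t
  define z1 where "z1 t = p \<psi> t *\<^sub>R w t + p \<psi>1 t *\<^sub>R y t" for t
  define z2 where "z2 t = (p \<psi> t *\<^sub>R w' t + p \<psi>1 t *\<^sub>R w t) + (p \<psi>1 t *\<^sub>R w t + p \<psi>2 t *\<^sub>R y t)" for t
  have dz: "(z has_vector_derivative z1 t) (at t)" for t
    by (rule has_vector_derivative_glue_zero)
       (unfold z_def[abs_def] z1_def, auto intro!: has_vector_derivative_scaleR pd dy simp: p0)
  have dz1: "(z1 has_vector_derivative z2 t) (at t)" for t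
  proof (rule has_vector_derivative_glue_zero)
    show "(z1 has_vector_derivative z2 t) (at t)" if "t > 0" for t
      unfolding z1_def[abs_def] z2_def
      by (rule has_vector_derivative_add[OF has_vector_derivative_scaleR[OF pd(1) dw[OF that]]
            has_vector_derivative_scaleR[OF pd(2) dy[OF that]]])
  qed (auto simp: z1_def z2_def p0)
  have cy: "continuous_on {0<..} y" "continuous_on {0<..} w"
    using tau by (auto intro: continuous_on_subset[OF cont(1)] continuous_on_subset[OF cont(2)])
  have cz: "continuous_on UNIV z" "continuous_on UNIV z1" "continuous_on UNIV z2"
    by (rule continuous_glue_zero; unfold z_def[abs_def] z1_def[abs_def] z2_def[abs_def];
        (intro continuous_intros pc cy cw')?; simp add: p0)+
  define a where "a = l * (k1 + k2)"
  have a: "a \<ge> 0" using pos by (simp add: a_def)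
  have yK: "norm (y t) \<le> K * exp (c * t)" "norm (w t) \<le> K * exp (c * t)" if "t \<ge> 0" for t
    using K(3)[of t] that tau norm_ge_zero[of "y t"] norm_ge_zero[of "w t"] by linarith+
  have w'K: "norm (w' t) \<le> a * (K * exp (c * t))" if t: "t \<ge> 0" for t
  proof -
    have "norm (of_real k1 * y (t - \<tau>) + of_real k2 * w (t - \<tau>)) \<le> k1 * norm (y (t - \<tau>)) + k2 * norm (w (t - \<tau>))"
      using norm_triangle_ineq[of "of_real k1 * y (t - \<tau>)" "of_real k2 * w (t - \<tau>)"] pos by (simp add: norm_mult)
    also have "\<dots> \<le> (k1 + k2) * (norm (y (t - \<tau>)) + norm (w (t - \<tau>)))"
      unfolding distrib_right using pos by (intro add_mono mult_left_mono) auto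
    also have "\<dots> \<le> (k1 + k2) * (K * exp (c * t))"
    proof (intro mult_left_mono)
      have "norm (y (t - \<tau>)) + norm (w (t - \<tau>)) \<le> K * exp (c * (t - \<tau>))" using K(3) t by simp
      also have "\<dots> \<le> K * exp (c * t)" using K tau by (intro mult_left_mono) (auto simp: mult_left_mono)
      finally show "norm (y (t - \<tau>)) + norm (w (t - \<tau>)) \<le> K * exp (c * t)" .
    qed (use pos in auto)
    finally show ?thesis using pos by (simp add: w'_def a_def norm_mult mult_left_mono mult.assoc)
  qed
  \<comment> \<open>Four products make up \<open>z2\<close>: the one with w' is bounded by b a K exp
    (c t), the other three by b K exp (c t) each.\<close>
  define K' where "K' = b * (a + 3) * K"
  have K': "K' \<ge> 0" using b0 a K by (simp add: K'_def)
  have scaled: "norm (r *\<^sub>R u) \<le> b * X" if "\<bar>r\<bar> \<le> b" "norm u \<le> X" for r and u :: complex and X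
    using that b0 by (auto intro!: mult_mono)
  have bds: "norm (z t) \<le> K' * exp (c * t) \<and> norm (z1 t) \<le> K' * exp (c * t) \<and> norm (z2 t) \<le> K' * exp (c * t)"
    if t: "t \<ge> 0" for t
  proof -
    define e where "e = K * exp (c * t)"
    have e: "e \<ge> 0" using K by (simp add: e_def)
    have 1: "norm (z t) \<le> b * e" unfolding z_def e_def by (intro scaled pb yK t)
    have 2: "norm (z1 t) \<le> b * e + b * e" unfolding z1_def e_def by (intro norm_triangle_mono scaled pb yK t)
    have 3: "norm (z2 t) \<le> (b * (a * e) + b * e) + (b * e + b * e)"
      unfolding z2_def e_def by (intro norm_triangle_mono scaled pb yK w'K t)
    have 4: "K' * exp (c * t) = b * (a * e) + 3 * (b * e)" by (simp add: K'_def e_def algebra_simps)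
    have 5: "b * e \<ge> 0" "b * (a * e) \<ge> 0" using b0 e a by simp_all
    show ?thesis using 1 2 3 5 unfolding 4 by linarith
  qed
  have causal: "causal K' c z" "causal K' c z1" "causal K' c z2"
    unfolding causal_def using cz bds by (auto simp: z_def z1_def z2_def p0)
  \<comment> \<open>After 4 + \<open>\<tau>\<close> the cutoff is 1 both at t and at t -
    \<open>\<tau>\<close>, so the equation of the mode is undisturbed.\<close>
  have ev: "z2 t + of_real l * (of_real k1 * z (t - \<tau>) + of_real k2 * z1 (t - \<tau>)) = 0"
    if t: "t \<ge> 4 + \<tau>" for t
  proof -
    have t4: "t \<ge> 4" "t - \<tau> \<ge> 4" using t tau by auto
    show ?thesis by (simp add: z_def z1_def z2_def p4[OF t4(1)] p4[OF t4(2)] w'_def)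
  qed
  have "4 + \<tau> \<ge> 0" using tau by simp
  obtain C \<delta> where C: "\<delta> > 0" "\<And>t. norm (z t) \<le> C * exp (- \<delta> * t)"
    using delay_mode_decay[OF dz dz1 causal K' K(2) \<open>4 + \<tau> \<ge> 0\<close> ev nz pos tau] by blast
  have "0 \<le> C * exp (- \<delta> * 0)" using C(2)[of 0] norm_ge_zero order_trans by blast
  then have "C \<ge> 0" by simp
  with C show ?thesis
    by (intro that[of \<delta> C]) (metis p4(1) scaleR_one z_def)+
qed

section \<open>From decay of positions to decay of velocities\<close>

lemma vector_derivative_bound_Icc:
  fixes f :: "real \<Rightarrow> 'a :: real_normed_vector"
  assumes "a \<le> b" and d: "\<And>x. x \<in> {a..b} \<Longrightarrow> (f has_vector_derivative f' x) (at x)"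
    and B: "\<And>x. x \<in> {a..b} \<Longrightarrow> norm (f' x) \<le> B"
  shows "norm (f b - f a) \<le> B * (b - a)"
proof (cases "a = b")
  case False
  have "norm (f b - f a) \<le> B * b - B * a"
  proof (rule differentiable_bound_general)
    show "continuous_on {a..b} f"
      using d by (meson continuous_at_imp_continuous_on has_vector_derivative_continuous)
    show "((\<lambda>x. B * x) has_vector_derivative B) (at x)" for x
      by (auto intro!: derivative_eq_intros simp: has_real_derivative_iff_has_vector_derivative[symmetric])
    show "(f has_vector_derivative f' x) (at x)" "norm (f' x) \<le> B" if "a < x" "x < b" for x
      using that by (auto intro: d B)
  qed (use assms(1) False in \<open>auto intro!: continuous_intros\<close>)
  then show ?thesis by (simp add: algebra_simps)
qed simp

lemma delay_mode_tendsto_0: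
  assumes m: "delay_mode l k1 k2 \<tau> y w" and tau: "\<tau> \<ge> 0" and pos: "l \<ge> 0" "k1 \<ge> 0" "k2 \<ge> 0"
    and nz: "\<And>s. Re s \<ge> 0 \<Longrightarrow> char_fun l k1 k2 \<tau> s \<noteq> 0"
  shows "(y \<longlongrightarrow> 0) at_top" "(w \<longlongrightarrow> 0) at_top"
proof -
  obtain C \<delta> where C: "\<delta> > 0" "C \<ge> 0" "\<And>t. t \<ge> 4 \<Longrightarrow> norm (y t) \<le> C * exp (- \<delta> * t)"
    using delay_mode_position_decay[OF m tau pos nz] by blast
  have lim: "((\<lambda>t. X * exp (- \<delta> * t)) \<longlongrightarrow> 0) at_top" for X using C(1) by real_asymp
  show "(y \<longlongrightarrow> 0) at_top"
    by (rule Lim_null_comparison[OF _ lim[of C]]) (use C(3) in \<open>auto simp: eventually_at_top_linorder\<close>)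
  \<comment> \<open>On [t, t + 1] the function \<open>u\<close> defined below moves by at most l k1
    E t, and passing from \<open>u\<close> back to \<open>w\<close> costs two delayed positions with
    weight l k2. \<open>E t\<close> bounds every position from time t - \<open>\<tau>\<close>
    on.\<close>
  define \<eta> where "\<eta> = l * k1 + 2 * (l * k2)"
  define E where "E t = C * exp (- \<delta> * (t - \<tau>))" for t
  have yE: "norm (y r) \<le> E t" if "t \<ge> 4 + \<tau>" "r \<ge> t - \<tau>" for r t
  proof -
    have "norm (y r) \<le> C * exp (- \<delta> * r)" using that by (intro C(3)) auto
    also have "\<dots> \<le> E t" unfolding E_def using C that by (intro mult_left_mono) (auto simp: mult_left_mono)
    finally show ?thesis .
  qed
  have bound: "norm (w t) \<le> (2 + \<eta>) * E t" if t: "t \<ge> 4 + \<tau>" for t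
  proof -
    have t0: "t > 0" using t tau by simp
    \<comment> \<open>The derivative of \<open>u\<close> involves only the position \<open>y\<close>, so \<open>w\<close> is nearly constant on
      \<open>[t, t + 1]\<close> and therefore close to \<open>y (t + 1) - y t\<close>.\<close>
    define u where "u r = w r + of_real (l * k2) * y (r - \<tau>)" for r
    have dy: "(y has_vector_derivative w r) (at r)" if "r > 0" for r
    proof -
      have "at r within {-\<tau>..} = at r" using that tau by (intro at_within_interior) auto
      moreover have "(y has_vector_derivative w r) (at r within {-\<tau>..})" using m that tau by (simp add: delay_mode_def)
      ultimately show ?thesis by simp
    qed
    have du: "(u has_vector_derivative - (of_real (l * k1) * y (r - \<tau>))) (at r)" if r: "r \<ge> t" for r
    proof -
      have r': "r > 0" "r - \<tau> > 0" using r t tau by auto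
      have "at r within {0..} = at r" using r' by (intro at_within_interior) auto
      moreover have "(w has_vector_derivative - (of_real l * (of_real k1 * y (r - \<tau>) + of_real k2 * w (r - \<tau>)))) (at r within {0..})"
        using m r' by (simp add: delay_mode_def)
      ultimately have 1: "(w has_vector_derivative - (of_real l * (of_real k1 * y (r - \<tau>) + of_real k2 * w (r - \<tau>)))) (at r)"
        by simp
      have "((\<lambda>r. r - \<tau>) has_vector_derivative 1) (at r)"
        by (auto intro!: derivative_eq_intros simp: has_real_derivative_iff_has_vector_derivative[symmetric])
      from vector_diff_chain_at[OF this dy[OF r'(2)]]
      have "((\<lambda>r. y (r - \<tau>)) has_vector_derivative w (r - \<tau>)) (at r)" by (simp add: o_def)
      from has_vector_derivative_add[OF 1 has_vector_derivative_mult_right[OF this, of "of_real (l * k2)"]]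
      show ?thesis unfolding u_def[abs_def] by (simp add: algebra_simps)
    qed
    have Et: "E t \<ge> 0" using C by (simp add: E_def)
    have wdiff: "norm (w r - w t) \<le> \<eta> * E t" if r: "t \<le> r" "r \<le> t + 1" for r
    proof -
      have "norm (u r - u t) \<le> (l * k1 * E t) * (r - t)"
      proof (rule vector_derivative_bound_Icc[OF r(1)])
        show "(u has_vector_derivative - (of_real (l * k1) * y (x - \<tau>))) (at x)" if "x \<in> {t..r}" for x
          using that by (intro du) auto
        show "norm (- (of_real (l * k1) * y (x - \<tau>))) \<le> l * k1 * E t" if "x \<in> {t..r}" for x
          using yE[OF t, of "x - \<tau>"] that pos by (auto simp: norm_mult intro!: mult_left_mono)
      qed
      also have "\<dots> \<le> (l * k1 * E t) * 1" using r pos Et by (intro mult_left_mono) auto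
      finally have 1: "norm (u r - u t) \<le> l * k1 * E t" by simp
      have 2: "norm (of_real (l * k2) * (y (r - \<tau>) - y (t - \<tau>))) \<le> l * k2 * (E t + E t)"
        unfolding norm_mult using yE[OF t, of "r - \<tau>"] yE[OF t, of "t - \<tau>"] r pos
        by (intro mult_mono order_trans[OF norm_triangle_ineq4] add_mono) (auto simp: norm_mult)
      have "w r - w t = (u r - u t) - of_real (l * k2) * (y (r - \<tau>) - y (t - \<tau>))"
        by (simp add: u_def algebra_simps)
      then have "norm (w r - w t) \<le> l * k1 * E t + l * k2 * (E t + E t)"
        using 1 2 norm_triangle_ineq4 order_trans add_mono by metis
      then show ?thesis by (simp add: \<eta>_def algebra_simps)
    qed
    have "norm ((y (t + 1) - (t + 1 - t) *\<^sub>R w t) - (y t - (t - t) *\<^sub>R w t)) \<le> (\<eta> * E t) * (t + 1 - t)"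
    proof (rule vector_derivative_bound_Icc[of t "t + 1" "\<lambda>r. y r - (r - t) *\<^sub>R w t" "\<lambda>r. w r - w t"])
      fix x assume x: "x \<in> {t..t+1}"
      have "((\<lambda>r. (r - t) *\<^sub>R w t) has_vector_derivative w t) (at x)"
        by (auto intro!: derivative_eq_intros simp: has_vector_derivative_def)
      then show "((\<lambda>r. y r - (r - t) *\<^sub>R w t) has_vector_derivative w x - w t) (at x)"
        using dy[of x] x t0 by (intro has_vector_derivative_diff) auto
    qed (use wdiff in auto)
    then have "norm (y (t + 1) - w t - y t) \<le> \<eta> * E t" by simp
    moreover have "norm (y (t + 1)) \<le> E t" "norm (y t) \<le> E t" using yE[OF t] tau by auto
    moreover have "norm (w t) \<le> norm (y (t + 1)) + norm (y t) + norm (y (t + 1) - w t - y t)" by norm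
    ultimately show ?thesis by (simp add: algebra_simps)
  qed
  have E: "(2 + \<eta>) * E t = ((2 + \<eta>) * C * exp (\<delta> * \<tau>)) * exp (- \<delta> * t)" for t
    by (simp add: E_def exp_add[symmetric] algebra_simps mult_exp_exp)
  show "(w \<longlongrightarrow> 0) at_top"
    by (rule Lim_null_comparison[OF _ lim[of "(2 + \<eta>) * C * exp (\<delta> * \<tau>)"]])
       (use bound[unfolded E] in \<open>auto simp: eventually_at_top_linorder\<close>)
qed

section \<open>Spectral decomposition of the graph Laplacian\<close>

text \<open>Gaussian elimination for a homogeneous system with unknowns indexed by \<open>K\<close>
  and equations by \<open>V\<close>: each induction step uses the equation at \<open>a\<close> to
  eliminate an unknown \<open>k0\<close> with nonzero coefficient.\<close>

lemma linear_dependence: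
  fixes w :: "'k \<Rightarrow> 'a \<Rightarrow> complex"
  assumes "finite V" "finite K" "card V < card K"
  shows "\<exists>c. (\<exists>k\<in>K. c k \<noteq> 0) \<and> (\<forall>i\<in>V. (\<Sum>k\<in>K. c k * w k i) = 0)"
  using assms
proof (induction V arbitrary: K w rule: finite_induct)
  case empty
  then obtain k where "k \<in> K" by fastforce
  then show ?case by (intro exI[of _ "\<lambda>_. 1"]) auto
next
  case (insert a V)
  show ?case
  proof (cases "\<exists>k0\<in>K. w k0 a \<noteq> 0")
    case False
    have "card V < card K" using insert by simp
    from insert.IH[OF insert.prems(1) this, of w]
    obtain c where "\<exists>k\<in>K. c k \<noteq> 0" "\<forall>i\<in>V. (\<Sum>k\<in>K. c k * w k i) = 0" by blast
    then show ?thesis using False by (intro exI[of _ c]) auto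
  next
    case True
    then obtain k0 where k0: "k0 \<in> K" "w k0 a \<noteq> 0" by blast
    let ?w = "\<lambda>k i. w k i - w k a / w k0 a * w k0 i"
    have "card V < card (K - {k0})" using insert k0 by simp
    from insert.IH[of "K - {k0}", OF _ this, of ?w] insert.prems(1)
    obtain c where c: "\<exists>k\<in>K - {k0}. c k \<noteq> 0" "\<And>i. i \<in> V \<Longrightarrow> (\<Sum>k\<in>K - {k0}. c k * ?w k i) = 0" by auto
    \<comment> \<open>The value at \<open>k0\<close> is chosen to solve the equation at
      \<open>a\<close>.\<close>
    define c' where "c' = c(k0 := - (\<Sum>k\<in>K - {k0}. c k * (w k a / w k0 a)))"
    have split: "(\<Sum>k\<in>K. c' k * w k i) = (\<Sum>k\<in>K - {k0}. c k * ?w k i)" for i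
    proof -
      have "(\<Sum>k\<in>K. c' k * w k i) = c' k0 * w k0 i + (\<Sum>k\<in>K - {k0}. c' k * w k i)"
        using insert.prems(1) k0(1) by (rule sum.remove)
      also have "(\<Sum>k\<in>K - {k0}. c' k * w k i) = (\<Sum>k\<in>K - {k0}. c k * w k i)"
        by (rule sum.cong) (auto simp: c'_def)
      also have "c' k0 * w k0 i = - (\<Sum>k\<in>K - {k0}. c k * (w k a / w k0 a) * w k0 i)"
        by (simp add: c'_def sum_distrib_right)
      finally show ?thesis by (simp add: algebra_simps sum_subtractf)
    qed
    have "(\<Sum>k\<in>K. c' k * w k i) = 0" if "i \<in> insert a V" for i
      using that c(2)[of i] k0(2) unfolding split by auto
    moreover have "\<exists>k\<in>K. c' k \<noteq> 0" using c(1) by (auto simp: c'_def)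
    ultimately show ?thesis by blast
  qed
qed

lemma of_real_cmod_square: "(of_real (cmod z))\<^sup>2 = z * cnj z"
  by (simp add: complex_norm_square[symmetric])

text \<open>Vectors indexed by \<open>V\<close> are represented by functions on the whole type that
  vanish off \<open>V\<close>; \<open>Nout\<close> makes this class invariant under the
  Laplacian.\<close>

locale laplacian =
  fixes V :: "'a set" and N :: "'a \<Rightarrow> 'a set"
  assumes finV: "finite V" and NV: "\<And>i. N i \<subseteq> V" and Nout: "\<And>i. i \<notin> V \<Longrightarrow> N i = {}"
    and Nsym: "\<And>i j. j \<in> N i \<longleftrightarrow> i \<in> N j"
begin

definition L :: "('a \<Rightarrow> complex) \<Rightarrow> 'a \<Rightarrow> complex" where
  "L f i = (\<Sum>j\<in>N i. f i - f j)"

text \<open>The adjacency matrix turns neighbour sums into double sums over \<open>V\<close>, where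
  symmetry becomes an exchange of summation order.\<close>

definition A :: "'a \<Rightarrow> 'a \<Rightarrow> real" where
  "A i j = (if j \<in> N i then 1 else 0)"

lemma A_sym: "A i j = A j i" using Nsym by (simp add: A_def)

lemma sum_N: "(\<Sum>j\<in>N i. f j) = (\<Sum>j\<in>V. of_real (A i j) * (f j :: complex))"
proof -
  have "(\<Sum>j\<in>V. of_real (A i j) * f j) = (\<Sum>j\<in>V. if j \<in> N i then f j else 0)"
    by (intro sum.cong) (auto simp: A_def)
  also have "\<dots> = (\<Sum>j\<in>V \<inter> N i. f j)" using finV by (simp add: sum.inter_restrict)
  also have "V \<inter> N i = N i" using NV by auto
  finally show ?thesis by simp
qed

lemma L_alt: "L f i = (\<Sum>j\<in>V. of_real (A i j) * (f i - f j))"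
  by (simp add: L_def sum_N)

lemma L_diff: "L (\<lambda>i. f i - g i) i = L f i - L g i"
  by (simp add: L_def sum_subtractf[symmetric] algebra_simps)

lemma L_cmult: "L (\<lambda>i. c * f i) i = c * L f i"
  by (simp add: L_def sum_distrib_left algebra_simps)

lemma L_sum: "L (\<lambda>i. \<Sum>k\<in>K. f k i) i = (\<Sum>k\<in>K. L (f k) i)"
  unfolding L_def by (simp add: sum_subtractf[symmetric]) (rule sum.swap)

lemma L_cnj: "L (\<lambda>i. cnj (f i)) i = cnj (L f i)"
  by (simp add: L_def cnj_sum)

lemma L_out: "i \<notin> V \<Longrightarrow> L f i = 0"
  by (simp add: L_def Nout)

text \<open>The pairing is bilinear, without conjugation. That is legitimate because the matrix of
  \<open>L\<close> is real and symmetric, and it suits pairings with conjugated eigenvectors as well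
  as with real trajectories.\<close>

lemma L_self_adjoint: "(\<Sum>i\<in>V. a i * L f i) = (\<Sum>i\<in>V. L a i * f i)"
proof -
  have "(\<Sum>i\<in>V. a i * L f i) = (\<Sum>i\<in>V. \<Sum>j\<in>V. of_real (A i j) * a i * f i) - (\<Sum>i\<in>V. \<Sum>j\<in>V. of_real (A i j) * a i * f j)"
    by (simp add: L_alt sum_distrib_left sum_subtractf[symmetric] algebra_simps)
  also have "(\<Sum>i\<in>V. \<Sum>j\<in>V. of_real (A i j) * a i * f j) = (\<Sum>i\<in>V. \<Sum>j\<in>V. of_real (A i j) * a j * f i)"
    by (subst sum.swap) (simp add: A_sym)
  also have "(\<Sum>i\<in>V. \<Sum>j\<in>V. of_real (A i j) * a i * f i) - \<dots> = (\<Sum>i\<in>V. L a i * f i)"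
    by (simp add: L_alt sum_distrib_right sum_distrib_left sum_subtractf[symmetric] algebra_simps)
  finally show ?thesis .
qed

lemma L_sum_zero: "(\<Sum>i\<in>V. L f i) = 0"
  using L_self_adjoint[of "\<lambda>_. 1" f] by (simp add: L_def)

text \<open>The Dirichlet energy over ordered pairs: every edge counts twice, whence the factor 2 in
  \<open>energy_eq\<close>.\<close>

definition energy :: "('a \<Rightarrow> complex) \<Rightarrow> real" where
  "energy f = (\<Sum>i\<in>V. \<Sum>j\<in>V. A i j * (cmod (f i - f j))\<^sup>2)"

lemma energy_eq: "of_real (energy f) = 2 * (\<Sum>i\<in>V. cnj (f i) * L f i)"
proof -
  have "of_real (energy f) = (\<Sum>i\<in>V. \<Sum>j\<in>V. of_real (A i j) * ((f i - f j) * cnj (f i - f j)))"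
    by (simp add: energy_def of_real_cmod_square del: complex_cnj_diff)
  also have "\<dots> = (\<Sum>i\<in>V. \<Sum>j\<in>V. of_real (A i j) * cnj (f i) * (f i - f j))
      + (\<Sum>i\<in>V. \<Sum>j\<in>V. of_real (A i j) * cnj (f j) * (f j - f i))"
    by (simp add: sum.distrib[symmetric] algebra_simps)
  also have "(\<Sum>i\<in>V. \<Sum>j\<in>V. of_real (A i j) * cnj (f j) * (f j - f i))
      = (\<Sum>i\<in>V. \<Sum>j\<in>V. of_real (A i j) * cnj (f i) * (f i - f j))"
    by (subst sum.swap) (simp add: A_sym)
  also have "(\<Sum>i\<in>V. \<Sum>j\<in>V. of_real (A i j) * cnj (f i) * (f i - f j)) = (\<Sum>i\<in>V. cnj (f i) * L f i)"
    by (simp add: L_alt sum_distrib_left algebra_simps)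
  finally show ?thesis by simp
qed

lemma energy_nonneg: "energy f \<ge> 0"
  unfolding energy_def by (intro sum_nonneg) (auto simp: A_def)

text \<open>Adding all missing edges can only increase the energy, and for the complete graph it is
  2 n sum |f i|^2 - 2 |sum f i|^2.\<close>

lemma energy_le: "energy f \<le> 2 * card V * (\<Sum>i\<in>V. (cmod (f i))\<^sup>2)"
proof -
  have "energy f \<le> (\<Sum>i\<in>V. \<Sum>j\<in>V. (cmod (f i - f j))\<^sup>2)"
    unfolding energy_def by (intro sum_mono) (auto simp: A_def)
  also have "\<dots> = 2 * card V * (\<Sum>i\<in>V. (cmod (f i))\<^sup>2) - 2 * (cmod (\<Sum>i\<in>V. f i))\<^sup>2"
  proof -
    have "complex_of_real (\<Sum>i\<in>V. \<Sum>j\<in>V. (cmod (f i - f j))\<^sup>2)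
      = (\<Sum>i\<in>V. \<Sum>j\<in>V. f i * cnj (f i)) + (\<Sum>i\<in>V. \<Sum>j\<in>V. f j * cnj (f j))
        - (\<Sum>i\<in>V. \<Sum>j\<in>V. f i * cnj (f j)) - (\<Sum>i\<in>V. \<Sum>j\<in>V. f j * cnj (f i))"
      by (simp only: of_real_sum complex_norm_square complex_cnj_diff)
         (simp add: sum.distrib sum_subtractf algebra_simps)
    also have "(\<Sum>i\<in>V. \<Sum>j\<in>V. f j * cnj (f i)) = (\<Sum>i\<in>V. \<Sum>j\<in>V. f i * cnj (f j))" by (rule sum.swap)
    also have "(\<Sum>i\<in>V. \<Sum>j\<in>V. f i * cnj (f j)) = of_real ((cmod (\<Sum>i\<in>V. f i))\<^sup>2)"
      by (simp only: complex_norm_square cnj_sum sum_product)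
    also have "(\<Sum>i\<in>V. \<Sum>j\<in>V. f i * cnj (f i)) = of_real (card V * (\<Sum>i\<in>V. (cmod (f i))\<^sup>2))"
      by (simp only: sum_constant of_real_mult of_real_sum complex_norm_square of_real_of_nat_eq sum_distrib_left)
    also have "(\<Sum>i\<in>V. \<Sum>j\<in>V. f j * cnj (f j)) = of_real (card V * (\<Sum>i\<in>V. (cmod (f i))\<^sup>2))"
      by (simp only: sum_constant of_real_mult of_real_sum complex_norm_square of_real_of_nat_eq)
    finally have "complex_of_real (\<Sum>i\<in>V. \<Sum>j\<in>V. (cmod (f i - f j))\<^sup>2)
      = of_real (2 * card V * (\<Sum>i\<in>V. (cmod (f i))\<^sup>2) - 2 * (cmod (\<Sum>i\<in>V. f i))\<^sup>2)" by simp
    then show ?thesis by (simp only: of_real_eq_iff)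
  qed
  finally show ?thesis by (smt (verit) zero_le_power2)
qed

definition eigen :: "complex \<Rightarrow> ('a \<Rightarrow> complex) \<Rightarrow> bool" where
  "eigen \<mu> f \<longleftrightarrow> (\<forall>i. L f i = \<mu> * f i) \<and> (\<forall>i. i \<notin> V \<longrightarrow> f i = 0)"

lemma eigen_energy:
  assumes "eigen \<mu> f"
  shows "of_real (energy f) = 2 * \<mu> * of_real (\<Sum>i\<in>V. (cmod (f i))\<^sup>2)"
proof -
  have "(\<Sum>i\<in>V. cnj (f i) * L f i) = \<mu> * of_real (\<Sum>i\<in>V. (cmod (f i))\<^sup>2)"
    using assms by (simp add: eigen_def of_real_cmod_square sum_distrib_left algebra_simps)
  then show ?thesis by (simp add: energy_eq)
qed

lemma sum_squares_pos:
  assumes "eigen \<mu> f" "f i \<noteq> 0"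
  shows "(\<Sum>i\<in>V. (cmod (f i))\<^sup>2) > 0"
proof -
  have "i \<in> V" using assms by (auto simp: eigen_def)
  then show ?thesis using finV assms(2) by (intro sum_pos2[of V i]) auto
qed

text \<open>The eigenvalue is the Rayleigh quotient energy / (2 sum |f i|^2), hence real,
  nonnegative and at most n by \<open>energy_le\<close>.\<close>

lemma eigenvalue_real:
  assumes e: "eigen \<mu> f" "f i \<noteq> 0"
  obtains l where "\<mu> = of_real l" "0 \<le> l" "l \<le> card V" "energy f = 2 * l * (\<Sum>i\<in>V. (cmod (f i))\<^sup>2)"
proof -
  define S where "S = (\<Sum>i\<in>V. (cmod (f i))\<^sup>2)"
  have S: "S > 0" using sum_squares_pos[OF e] by (simp add: S_def)
  define l where "l = energy f / (2 * S)"
  have "complex_of_real (energy f) = 2 * \<mu> * of_real S" using eigen_energy[OF e(1)] by (simp add: S_def)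
  then have 1: "\<mu> = of_real l" using S by (simp add: l_def field_simps)
  have "energy f \<le> 2 * card V * S" using energy_le[of f] by (simp add: S_def)
  then show ?thesis using S energy_nonneg[of f] by (intro that[OF 1]) (auto simp: l_def S_def[symmetric] field_simps)
qed

definition eigen_sum :: "('a \<Rightarrow> complex) \<Rightarrow> bool" where
  "eigen_sum u \<longleftrightarrow> (\<exists>M e. finite M \<and> (\<forall>\<mu>. eigen \<mu> (e \<mu>)) \<and> u = (\<lambda>i. \<Sum>\<mu>\<in>M. e \<mu> i))"

text \<open>Self-adjointness enters here: the generalized eigenvectors of \<open>L\<close> are eigenvectors, so that
  repeated roots of an annihilating polynomial do no harm.\<close>

lemma eigen_sum_step:
  assumes u0: "\<And>i. i \<notin> V \<Longrightarrow> u i = 0" and es: "eigen_sum (\<lambda>i. L u i - a * u i)"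
  shows "eigen_sum u"
proof -
  from es obtain M e where M: "finite M" and e: "\<And>\<mu>. eigen \<mu> (e \<mu>)"
    and eq: "(\<lambda>i. L u i - a * u i) = (\<lambda>i. \<Sum>\<mu>\<in>M. e \<mu> i)" unfolding eigen_sum_def by blast
  have eL: "L (e \<mu>) i = \<mu> * e \<mu> i" for \<mu> i using e by (simp add: eigen_def)
  have e0: "i \<notin> V \<Longrightarrow> e \<mu> i = 0" for \<mu> i using e by (simp add: eigen_def)
  define ea where "ea i = (if a \<in> M then e a i else 0)" for i
  \<comment> \<open>Division by \<open>\<mu>\<close> - a inverts L - a on the eigenvectors with
    \<open>\<mu> \<noteq> a\<close>. Subtracting these preimages from u leaves \<open>v\<close>,
    which L - a sends to the component \<open>ea\<close> at the eigenvalue a.\<close>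
  define d where "d \<mu> i = (1 / (\<mu> - a)) * e \<mu> i" for \<mu> i
  define v where "v i = u i - (\<Sum>\<mu>\<in>M - {a}. d \<mu> i)" for i
  have dL: "L (d \<mu>) i = \<mu> * d \<mu> i" for \<mu> i
    unfolding d_def[abs_def] L_cmult eL by simp
  have ea: "eigen a ea" using e[of a] by (cases "a \<in> M") (auto simp: ea_def[abs_def] eigen_def L_def)
  have v: "L v i - a * v i = ea i" for i
  proof -
    have "L v i - a * v i = (L u i - a * u i) - (\<Sum>\<mu>\<in>M - {a}. (\<mu> - a) * d \<mu> i)"
      unfolding v_def[abs_def] L_diff L_sum dL
      by (simp add: algebra_simps sum_subtractf sum_distrib_left)
    also have "(\<Sum>\<mu>\<in>M - {a}. (\<mu> - a) * d \<mu> i) = (\<Sum>\<mu>\<in>M - {a}. e \<mu> i)"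
      by (intro sum.cong) (auto simp: d_def)
    also have "L u i - a * u i = (\<Sum>\<mu>\<in>M. e \<mu> i)" using eq by meson
    also have "\<dots> - (\<Sum>\<mu>\<in>M - {a}. e \<mu> i) = ea i"
      using M by (cases "a \<in> M") (auto simp: ea_def sum.remove)
    finally show ?thesis .
  qed
  \<comment> \<open>\<open>ea\<close> lies both in the kernel and in the range of L - a, so
    self-adjointness and the reality of a make its norm vanish. Then \<open>v\<close> itself is an
    eigenvector.\<close>
  have ea_zero: "ea i = 0" for i
  proof (rule ccontr)
    assume nz: "ea i \<noteq> 0"
    obtain l where l: "a = of_real l" using eigenvalue_real[OF ea nz] by blast
    have Lc: "L (\<lambda>i. cnj (ea i)) i = a * cnj (ea i)" for i
      unfolding L_cnj using ea l by (simp add: eigen_def)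
    have "of_real (\<Sum>i\<in>V. (cmod (ea i))\<^sup>2) = (\<Sum>i\<in>V. cnj (ea i) * (L v i - a * v i))"
      unfolding v by (simp add: of_real_cmod_square mult.commute)
    also have "\<dots> = (\<Sum>i\<in>V. cnj (ea i) * L v i) - (\<Sum>i\<in>V. a * cnj (ea i) * v i)"
      by (simp add: algebra_simps sum_subtractf)
    also have "\<dots> = 0" unfolding L_self_adjoint Lc by simp
    finally show False using sum_squares_pos[OF ea nz] by (simp only: of_real_eq_0_iff)
  qed
  define e' where "e' = (\<lambda>\<mu>. if \<mu> = a then v else d \<mu>)"
  have v0: "i \<notin> V \<Longrightarrow> v i = 0" for i using u0 e0 by (simp add: v_def d_def)
  have "eigen \<mu> (e' \<mu>)" for \<mu>
  proof (cases "\<mu> = a")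
    case True
    then show ?thesis using v ea_zero v0 by (simp add: e'_def eigen_def)
  next
    case False
    then show ?thesis using dL e0 by (simp add: e'_def eigen_def d_def)
  qed
  moreover have "u = (\<lambda>i. \<Sum>\<mu>\<in>insert a M. e' \<mu> i)"
  proof
    fix i
    have "(\<Sum>\<mu>\<in>insert a M. e' \<mu> i) = e' a i + (\<Sum>\<mu>\<in>M - {a}. e' \<mu> i)"
      using M by (rule sum.insert_remove)
    also have "(\<Sum>\<mu>\<in>M - {a}. e' \<mu> i) = (\<Sum>\<mu>\<in>M - {a}. d \<mu> i)"
      by (intro sum.cong) (auto simp: e'_def)
    finally show "u i = (\<Sum>\<mu>\<in>insert a M. e' \<mu> i)" by (simp add: e'_def v_def)
  qed
  ultimately show ?thesis unfolding eigen_sum_def using M by blast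
qed

lemma Lpow_out: "(\<And>i. i \<notin> V \<Longrightarrow> u i = 0) \<Longrightarrow> i \<notin> V \<Longrightarrow> (L ^^ k) u i = 0"
  by (cases k) (auto simp: L_out)

lemma Lpow_diff: "(L ^^ k) (\<lambda>i. L u i - a * u i) = (\<lambda>i. (L ^^ Suc k) u i - a * (L ^^ k) u i)"
proof (induction k)
  case (Suc k)
  show ?case by (simp add: Suc.IH L_diff L_cmult fun_eq_iff)
qed auto

text \<open>Induction on the degree: if p = (X - a) q annihilates u, then q annihilates (L - a) u,
  and \<open>eigen_sum_step\<close> lifts the expansion back to u. A nonzero constant p forces u =
  0, the empty sum.\<close>

lemma eigen_sum_if_annihilated:
  assumes "p \<noteq> 0" "\<And>i. i \<notin> V \<Longrightarrow> u i = 0"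
    and "\<And>i. (\<Sum>k\<le>degree p. coeff p k * (L ^^ k) u i) = 0"
  shows "eigen_sum u"
  using assms
proof (induction "degree p" arbitrary: p u)
  case 0
  then obtain c where c: "p = [:c:]" by (metis degree_eq_zeroE)
  then have "u = (\<lambda>i. \<Sum>\<mu>\<in>{}. 0)" using 0 by auto
  then show ?case unfolding eigen_sum_def
    by (intro exI[of _ "{}"] exI[of _ "\<lambda>_ _. 0"]) (auto simp: eigen_def L_def)
next
  case (Suc m)
  have "\<not> constant (poly p)" using Suc.hyps(2) by (simp add: constant_degree)
  then obtain a where "poly p a = 0" using fundamental_theorem_of_algebra by blast
  then obtain q where q: "p = [:- a, 1:] * q" by (metis dvdE poly_eq_0_iff_dvd)
  have q0: "q \<noteq> 0" using q Suc.prems(1) by auto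
  have "degree p = Suc (degree q)" unfolding q using q0 by (subst degree_mult_eq) auto
  then have dq: "m = degree q" using Suc.hyps(2) by simp
  have "(\<Sum>k\<le>m. coeff q k * (L ^^ k) (\<lambda>i. L u i - a * u i) i) = 0" for i
  proof -
    have cp: "coeff p k = coeff (pCons 0 q) k - a * coeff q k" for k
      unfolding q by simp
    have "0 = (\<Sum>k\<le>Suc m. coeff p k * (L ^^ k) u i)" using Suc.prems(3)[of i] Suc.hyps(2) by simp
    also have "\<dots> = (\<Sum>k\<le>Suc m. coeff (pCons 0 q) k * (L ^^ k) u i) - a * (\<Sum>k\<le>Suc m. coeff q k * (L ^^ k) u i)"
      unfolding cp by (simp only: left_diff_distrib sum_subtractf sum_distrib_left mult.assoc)
    also have "(\<Sum>k\<le>Suc m. coeff (pCons 0 q) k * (L ^^ k) u i) = (\<Sum>k\<le>m. coeff q k * (L ^^ Suc k) u i)"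
      by (subst sum.atMost_Suc_shift) simp
    also have "(\<Sum>k\<le>Suc m. coeff q k * (L ^^ k) u i) = (\<Sum>k\<le>m. coeff q k * (L ^^ k) u i)"
      using dq by (simp add: coeff_eq_0)
    finally show ?thesis
      unfolding Lpow_diff by (simp only: right_diff_distrib sum_subtractf sum_distrib_left mult.left_commute)
  qed
  then have "eigen_sum (\<lambda>i. L u i - a * u i)"
    using Suc.hyps(1)[of q "\<lambda>i. L u i - a * u i"] q0 dq Suc.prems(2) L_out by simp
  then show ?case using eigen_sum_step Suc.prems(2) by blast
qed

text \<open>The n + 1 Krylov vectors u, L u, ..., L^n u live in dimension n = card V, so a
  nontrivial relation among them supplies the annihilating polynomial.\<close>

theorem eigen_sum_exists:
  assumes u0: "\<And>i. i \<notin> V \<Longrightarrow> u i = 0"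
  shows "eigen_sum u"
proof -
  let ?n = "card V"
  obtain c where c: "\<exists>k\<in>{..?n}. c k \<noteq> 0" "\<And>i. i \<in> V \<Longrightarrow> (\<Sum>k\<le>?n. c k * (L ^^ k) u i) = 0"
    using linear_dependence[OF finV, of "{..?n}" "\<lambda>k. (L ^^ k) u"] by auto
  define p where "p = (\<Sum>k\<le>?n. monom (c k) k)"
  have cp: "coeff p k = (if k \<le> ?n then c k else 0)" for k
    by (simp add: p_def coeff_sum)
  have p0: "p \<noteq> 0" using c(1) cp by (metis atMost_iff coeff_0)
  have dp: "degree p \<le> ?n" by (rule degree_le) (simp add: cp)
  show ?thesis
  proof (rule eigen_sum_if_annihilated[OF p0 u0])
    fix i
    have "(\<Sum>k\<le>degree p. coeff p k * (L ^^ k) u i) = (\<Sum>k\<le>?n. coeff p k * (L ^^ k) u i)"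
      using dp by (intro sum.mono_neutral_left) (auto simp: coeff_eq_0)
    also have "\<dots> = (\<Sum>k\<le>?n. c k * (L ^^ k) u i)" by (intro sum.cong) (auto simp: cp)
    also have "\<dots> = 0" using c(2)[of i] Lpow_out[OF u0] by (cases "i \<in> V") auto
    finally show "(\<Sum>k\<le>degree p. coeff p k * (L ^^ k) u i) = 0" .
  qed
qed

end

section \<open>Connectedness and the reduction to scalar modes\<close>

context laplacian
begin

text \<open>Each summand of the energy is nonnegative, so zero energy makes f agree across every
  edge, and equality propagates along paths.\<close>

lemma energy_zero_const:
  assumes "energy f = 0" and "(i, j) \<in> {(i, j). j \<in> N i}\<^sup>*"
  shows "f i = f j"
  using assms(2)
proof (induction rule: rtrancl_induct)
  case (step j k)
  have k: "k \<in> N j" and V: "j \<in> V" "k \<in> V" using step(2) NV Nout by fastforce+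
  have nn: "A i j * (cmod (f i - f j))\<^sup>2 \<ge> 0" for i j by (simp add: A_def)
  have "(\<Sum>k\<in>V. A j k * (cmod (f j - f k))\<^sup>2) = 0"
    using assms(1) finV V(1) nn unfolding energy_def
    by (subst (asm) sum_nonneg_eq_0_iff) (auto intro!: sum_nonneg)
  then have "A j k * (cmod (f j - f k))\<^sup>2 = 0"
    using finV V(2) nn by (subst (asm) sum_nonneg_eq_0_iff) auto
  then show ?case using step k by (simp add: A_def)
qed simp

text \<open>Eigenvectors for nonzero eigenvalues have sum 0, since the entries of every L f do. A
  component at eigenvalue 0 is constant by connectedness and inherits sum 0 from u, so it
  vanishes.\<close>

lemma sum_zero_eigen_sum:
  assumes conn: "\<And>i j. i \<in> V \<Longrightarrow> j \<in> V \<Longrightarrow> (i, j) \<in> {(i, j). j \<in> N i}\<^sup>*"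
    and u0: "\<And>i. i \<notin> V \<Longrightarrow> u i = 0" and sum0: "(\<Sum>i\<in>V. u i) = 0"
  obtains M e where "finite M" "\<And>\<mu>. eigen \<mu> (e \<mu>)" "\<And>i. u i = (\<Sum>\<mu>\<in>M. e \<mu> i)"
    "\<And>\<mu> i. \<mu> \<in> M \<Longrightarrow> e \<mu> i \<noteq> 0 \<Longrightarrow> \<exists>l. \<mu> = of_real l \<and> 0 < l \<and> l \<le> card V"
proof -
  have "eigen_sum u" by (rule eigen_sum_exists) (rule u0)
  then obtain M e where Me: "finite M \<and> (\<forall>\<mu>. eigen \<mu> (e \<mu>)) \<and> u = (\<lambda>i. \<Sum>\<mu>\<in>M. e \<mu> i)"
    unfolding eigen_sum_def by (elim exE)
  have M: "finite M" "\<And>\<mu>. eigen \<mu> (e \<mu>)" "u = (\<lambda>i. \<Sum>\<mu>\<in>M. e \<mu> i)"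
    using Me by simp_all
  show ?thesis
  proof (rule that[OF M(1,2)])
    show "u i = (\<Sum>\<mu>\<in>M. e \<mu> i)" for i using M(3) by simp
    fix \<mu> i assume \<mu>: "\<mu> \<in> M" and nz: "e \<mu> i \<noteq> 0"
    obtain l where l: "\<mu> = of_real l" "0 \<le> l" "l \<le> card V"
      "energy (e \<mu>) = 2 * l * (\<Sum>i\<in>V. (cmod (e \<mu> i))\<^sup>2)"
      using eigenvalue_real[OF M(2) nz] by blast
    have "l \<noteq> 0"
    proof
      assume l0: "l = 0"
      have iV: "i \<in> V" using M(2)[of \<mu>] nz by (auto simp: eigen_def)
      have const: "e \<mu> j = e \<mu> i" if "j \<in> V" for j
        using energy_zero_const[of "e \<mu>" j i] conn[OF that iV] l(4) l0 by simp
      have other: "(\<Sum>i\<in>V. e \<nu> i) = 0" if "\<nu> \<noteq> \<mu>" for \<nu>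
      proof -
        have "\<nu> * (\<Sum>i\<in>V. e \<nu> i) = (\<Sum>i\<in>V. L (e \<nu>) i)"
          using M(2)[of \<nu>] by (simp add: eigen_def sum_distrib_left)
        then show ?thesis using that l(1) l0 by (simp add: L_sum_zero)
      qed
      have "0 = (\<Sum>\<nu>\<in>M. \<Sum>i\<in>V. e \<nu> i)" using sum0 unfolding M(3) by (subst sum.swap) simp
      also have "\<dots> = (\<Sum>i\<in>V. e \<mu> i)"
        using M(1) \<mu> other by (subst sum.remove[of M \<mu>]) auto
      also have "\<dots> = of_nat (card V) * e \<mu> i" using const by simp
      finally show False using nz iV finV by auto
    qed
    then show "\<exists>l. \<mu> = of_real l \<and> 0 < l \<and> l \<le> card V" using l by force
  qed
qed

text \<open>Pairing the network with an eigenvector moves L from the trajectory onto f by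
  self-adjointness, where it becomes the scalar l; the coupled system collapses to one
  equation.\<close>

lemma eigen_delay_mode:
  fixes x v :: "'a \<Rightarrow> real \<Rightarrow> real"
  assumes e: "eigen (of_real l) f"
    and cv: "\<And>i. i \<in> V \<Longrightarrow> continuous_on {-\<tau>..0} (v i)"
    and dx: "\<And>i t. i \<in> V \<Longrightarrow> t \<ge> - \<tau> \<Longrightarrow> (x i has_real_derivative v i t) (at t within {-\<tau>..})"
    and dv: "\<And>i t. i \<in> V \<Longrightarrow> t \<ge> 0 \<Longrightarrow> (v i has_real_derivative
        k1 * (\<Sum>j\<in>N i. x j (t - \<tau>) - x i (t - \<tau>)) + k2 * (\<Sum>j\<in>N i. v j (t - \<tau>) - v i (t - \<tau>))) (at t within {0..})"
  shows "delay_mode l k1 k2 \<tau> (\<lambda>t. \<Sum>i\<in>V. f i * of_real (x i t)) (\<lambda>t. \<Sum>i\<in>V. f i * of_real (v i t))"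
  unfolding delay_mode_def
proof (intro conjI allI impI)
  show "continuous_on {-\<tau>..0} (\<lambda>t. \<Sum>i\<in>V. f i * complex_of_real (v i t))"
    using cv by (intro continuous_intros) auto
  have lin: "((\<lambda>t. \<Sum>i\<in>V. f i * complex_of_real (g i t)) has_vector_derivative (\<Sum>i\<in>V. f i * of_real (g' i))) F"
    if "\<And>i. i \<in> V \<Longrightarrow> (g i has_real_derivative g' i) F" for g g' F
    using that
    by (intro has_vector_derivative_sum has_vector_derivative_mult_right has_vector_derivative_of_real)
      (simp add: has_real_derivative_iff_has_vector_derivative)
  show "((\<lambda>t. \<Sum>i\<in>V. f i * complex_of_real (x i t)) has_vector_derivative (\<Sum>i\<in>V. f i * of_real (v i t)))
      (at t within {-\<tau>..})" if "t \<ge> - \<tau>" for t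
    using dx that by (intro lin)
  have adj: "(\<Sum>i\<in>V. f i * of_real (\<Sum>j\<in>N i. g j - g i)) = - (of_real l * (\<Sum>i\<in>V. f i * of_real (g i)))"
    for g :: "'a \<Rightarrow> real"
  proof -
    have "(\<Sum>i\<in>V. f i * of_real (\<Sum>j\<in>N i. g j - g i)) = - (\<Sum>i\<in>V. f i * L (\<lambda>i. of_real (g i)) i)"
      by (simp add: L_def sum_negf[symmetric] minus_mult_right)
    also have "\<dots> = - (\<Sum>i\<in>V. L f i * of_real (g i))" by (simp only: L_self_adjoint)
    finally show ?thesis using e by (simp add: eigen_def sum_distrib_left mult.assoc)
  qed
  have comb: "(\<Sum>i\<in>V. f i * of_real (k1 * X i + k2 * Y i))
      = of_real k1 * (\<Sum>i\<in>V. f i * of_real (X i)) + of_real k2 * (\<Sum>i\<in>V. f i * of_real (Y i))"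
    for X Y :: "'a \<Rightarrow> real"
    by (simp add: sum.distrib sum_distrib_left algebra_simps)
  fix t :: real assume t: "t \<ge> 0"
  let ?p = "\<lambda>i. k1 * (\<Sum>j\<in>N i. x j (t - \<tau>) - x i (t - \<tau>)) + k2 * (\<Sum>j\<in>N i. v j (t - \<tau>) - v i (t - \<tau>))"
  have "(\<Sum>i\<in>V. f i * of_real (?p i))
      = of_real k1 * (\<Sum>i\<in>V. f i * of_real (\<Sum>j\<in>N i. x j (t - \<tau>) - x i (t - \<tau>)))
      + of_real k2 * (\<Sum>i\<in>V. f i * of_real (\<Sum>j\<in>N i. v j (t - \<tau>) - v i (t - \<tau>)))"
    by (rule comb)
  also have "\<dots> = - (of_real l * (of_real k1 * (\<Sum>i\<in>V. f i * of_real (x i (t - \<tau>)))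
      + of_real k2 * (\<Sum>i\<in>V. f i * of_real (v i (t - \<tau>)))))"
    unfolding adj by (simp add: algebra_simps)
  finally have eq: "(\<Sum>i\<in>V. f i * of_real (?p i)) = \<dots>" .
  show "((\<lambda>t. \<Sum>i\<in>V. f i * complex_of_real (v i t)) has_vector_derivative
      - (of_real l * (of_real k1 * (\<Sum>i\<in>V. f i * of_real (x i (t - \<tau>)))
      + of_real k2 * (\<Sum>i\<in>V. f i * of_real (v i (t - \<tau>)))))) (at t within {0..})"
    unfolding eq[symmetric] by (rule lin) (rule dv[OF _ t])
qed

end

section \<open>Communication graphs and the consensus theorem\<close>

lemma laplacian_pair_graph:
  assumes "pair_graph G"
  shows "laplacian (pverts G) (neighbours G)"
proof -
  interpret pair_graph G by fact
  show ?thesis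
  proof
    show "finite (pverts G)" by (rule pair_finite_verts)
    show "neighbours G i \<subseteq> pverts G" for i using arc_snd_in_verts by (force simp: neighbours_def)
    show "neighbours G i = {}" if "i \<notin> pverts G" for i
      using that arc_fst_in_verts by (force simp: neighbours_def)
    show "j \<in> neighbours G i \<longleftrightarrow> i \<in> neighbours G j" for i j
      using pair_sym_arcs by (auto simp: neighbours_def symmetric_def sym_def)
  qed
qed

text \<open>Connectedness means reachability in the symmetric closure, and for a symmetric graph
  that closure adds no arcs.\<close>

lemma connected_pair_graph_rtrancl:
  assumes "pair_graph G" and conn: "Digraph_Component.connected (with_proj G)"
    and ij: "i \<in> pverts G" "j \<in> pverts G"
  shows "(i, j) \<in> {(i, j). j \<in> neighbours G i}\<^sup>*"
proof -
  interpret pair_graph G by fact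
  have "(i, j) \<in> rtrancl_on (pverts G) (parcs (mk_symmetric (with_proj G)))"
    using conn ij by (auto simp: connected_def strongly_connected_def reachable_def)
  moreover have "parcs (mk_symmetric (with_proj G)) \<subseteq> {(i, j). j \<in> neighbours G i}"
    using pair_sym_arcs by (auto simp: parcs_mk_symmetric neighbours_def symmetric_def sym_def)
  ultimately show ?thesis by (metis rtrancl_on_rtranclI rtrancl_mono subsetD)
qed

theorem mainTheorem2:
  fixes n :: nat and k1 k2 \<tau> :: real
  assumes "n \<ge> 2" and "k1 > 0" and "k2 > 0"
    and "0 \<le> \<tau>" and "\<tau> < tau_crit k1 k2 n"
  shows "\<forall>G :: 'a pair_pre_digraph.
           pair_graph G \<and> Digraph_Component.connected (with_proj G) \<and> card (pverts G) = n
             \<longrightarrow> reaches_consensus G k1 k2 \<tau>"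
proof (intro allI impI, elim conjE)
  fix G :: "'a pair_pre_digraph"
  assume G: "pair_graph G" and conn: "Digraph_Component.connected (with_proj G)" and n: "card (pverts G) = n"
  interpret laplacian "pverts G" "neighbours G" by (rule laplacian_pair_graph[OF G])
  show "reaches_consensus G k1 k2 \<tau>"
    unfolding reaches_consensus_def
  proof (intro allI impI ballI conjI)
    fix \<phi> \<phi>' x v a b
    assume hist: "initial_history G \<tau> \<phi> \<phi>'" and sol: "closed_loop_solution G k1 k2 \<tau> \<phi> \<phi>' x v"
      and ab: "a \<in> pverts G" "b \<in> pverts G"
    \<comment> \<open>Pairing with \<open>u\<close> reads off the disagreement of a and b; its
      entries sum to 0, so its expansion has no component at eigenvalue 0.\<close>
    define u :: "'a \<Rightarrow> complex" where "u i = of_bool (i = a) - of_bool (i = b)" for i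
    have u_sum: "(\<Sum>i\<in>pverts G. u i * g i) = g a - g b" for g
    proof -
      have "(\<Sum>i\<in>pverts G. u i * g i)
          = (\<Sum>i\<in>pverts G. (if i = a then g i else 0) - (if i = b then g i else 0))"
        by (intro sum.cong) (auto simp: u_def)
      then show ?thesis using finV ab by (simp add: sum_subtractf)
    qed
    obtain M e where M: "finite M" "\<And>\<mu>. eigen \<mu> (e \<mu>)" "\<And>i. u i = (\<Sum>\<mu>\<in>M. e \<mu> i)"
      and ev: "\<And>\<mu> i. \<mu> \<in> M \<Longrightarrow> e \<mu> i \<noteq> 0 \<Longrightarrow> \<exists>l. \<mu> = of_real l \<and> 0 < l \<and> l \<le> card (pverts G)"
    proof (rule sum_zero_eigen_sum[of u])
      show "(i, j) \<in> {(i, j). j \<in> neighbours G i}\<^sup>*" if "i \<in> pverts G" "j \<in> pverts G" for i j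
        using connected_pair_graph_rtrancl[OF G conn that] .
      show "u i = 0" if "i \<notin> pverts G" for i using that ab by (auto simp: u_def)
      show "(\<Sum>i\<in>pverts G. u i) = 0" using u_sum[of "\<lambda>_. 1"] by simp
    qed blast
    have cv: "continuous_on {-\<tau>..0} (v i)" if "i \<in> pverts G" for i
      using hist sol that continuous_on_cong[of "{-\<tau>..0}" "{-\<tau>..0}" "v i" "\<phi>' i"]
      unfolding initial_history_def closed_loop_solution_def by metis
    have mode: "((\<lambda>t. \<Sum>i\<in>pverts G. e \<mu> i * of_real (x i t)) \<longlongrightarrow> 0) at_top \<and>
        ((\<lambda>t. \<Sum>i\<in>pverts G. e \<mu> i * of_real (v i t)) \<longlongrightarrow> 0) at_top" if \<mu>: "\<mu> \<in> M" for \<mu>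
    proof (cases "\<exists>i. e \<mu> i \<noteq> 0")
      case True
      then obtain l where l: "\<mu> = of_real l" "0 < l" "l \<le> real n" using ev[OF \<mu>] n by blast
      have "delay_mode l k1 k2 \<tau> (\<lambda>t. \<Sum>i\<in>pverts G. e \<mu> i * of_real (x i t)) (\<lambda>t. \<Sum>i\<in>pverts G. e \<mu> i * of_real (v i t))"
        using M(2)[of \<mu>] cv sol unfolding l(1) closed_loop_solution_def protocol_def
        by (intro eigen_delay_mode) auto
      from delay_mode_tendsto_0[OF this] show ?thesis
        using assms l char_fun_nonzero_tau_crit[OF l(2,3) assms(2-5)] by simp
    qed simp
    have limit: "((\<lambda>t. g a t - g b t) \<longlongrightarrow> 0) at_top"
      if g: "\<And>\<mu>. \<mu> \<in> M \<Longrightarrow> ((\<lambda>t. \<Sum>i\<in>pverts G. e \<mu> i * of_real (g i t)) \<longlongrightarrow> 0) at_top" for g :: "'a \<Rightarrow> real \<Rightarrow> real"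
    proof -
      have "((\<lambda>t. \<Sum>\<mu>\<in>M. \<Sum>i\<in>pverts G. e \<mu> i * of_real (g i t)) \<longlongrightarrow> (\<Sum>\<mu>\<in>M. 0)) at_top"
        using g by (intro tendsto_sum)
      also have "(\<lambda>t. \<Sum>\<mu>\<in>M. \<Sum>i\<in>pverts G. e \<mu> i * of_real (g i t)) = (\<lambda>t. of_real (g a t - g b t))"
        by (subst sum.swap) (simp only: sum_distrib_right[symmetric] M(3)[symmetric] u_sum of_real_diff)
      finally have "((\<lambda>t. complex_of_real (g a t - g b t)) \<longlongrightarrow> of_real 0) at_top" by simp
      then show ?thesis by (simp only: tendsto_of_real_iff)
    qed
    show "((\<lambda>t. x a t - x b t) \<longlongrightarrow> 0) at_top" "((\<lambda>t. v a t - v b t) \<longlongrightarrow> 0) at_top"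
      using mode by (auto intro: limit)
  qed
qed

end
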